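(* Let $\sigma$ be an order-two $*$-automorphism of a unital C*-algebra $A$, and let $W$ be the canonical unitary of the C*-crossed-product $A\rtimes_\sigma\mathbb{Z}_2$, so that $W^2=1$ and $WaW=\sigma(a)$ for all $a\in A$. Let $\pi$ be an irreducible representation of $A\rtimes_\sigma\mathbb{Z}_2$ on a Hilbert space $\mathcal{H}$. Let $\pi'$ be the restriction of $\pi$ to $A$ and $\pi''$ the restriction of $\pi$ to the fixed point C*-algebra $A_1$. Then one and only one of the following two alternatives holds: (1) The operator $\pi(W)$ is either $\mathrm{Id}$ or $-\mathrm{Id}$, and $\pi(A\rtimes_\sigma\mathbb{Z}_2)=\pi'(A)=\pi''(A_1)$. (2) The spectrum of $\pi(W)$ is $\{-1,1\}$. Then $\mathcal{H}=\mathcal{H}_1\oplus\mathcal{H}_{-1}$, where $\mathcal{H}_\varepsilon$ is the eigenspace of $\pi(W)$ for the eigenvalue $\varepsilon\in\{1,-1\}$, and in this decomposition $\pi(W)=\begin{pmatrix}1&0\\0&-1\end{pmatrix}$. Write, with respect to this decomposition, $\pi'(a)=\begin{pmatrix}\alpha(a)&\beta(a)\\ \gamma(a)&\delta(a)\end{pmatrix}$ for $a\in A$. Then $\alpha$ and $\delta$ restrict to irreducible representations of $A_1$ (on $\mathcal{H}_1$ and $\mathcal{H}_{-1}$ respectively), $\alpha(A_{-1})=\delta(A_{-1})=\{0\}$, and $\beta(A_1)=\gamma(A_1)=\{0\}$. Furthermore, the representation $\pi'$ of $A$ is irreducible if and only if $\alpha$ and $\delta$ are not unitarily equivalent as representations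 of $A_1$.
   Context: For an order-two $*$-automorphism $\sigma$ of a unital C*-algebra $A$, the crossed-product $A\rtimes_\sigma\mathbb{Z}_2$ is the universal unital C*-algebra generated by $A$ and a unitary $W$ (the canonical unitary) subject to $W^2=1$ and $WaW^*=\sigma(a)$ for all $a\in A$: any unital $*$-morphism $\psi:A\to B$ into a unital C*-algebra $B$ containing a unitary $u$ with $u^2=1$ and $u\psi(a)u^*=\psi(\sigma(a))$ for all $a\in A$ extends uniquely to $A\rtimes_\sigma\mathbb{Z}_2$ with $\psi(W)=u$. Put $A_1=\{a\in A:\sigma(a)=a\}$ (the fixed point C*-algebra) and $A_{-1}=\{a\in A:\sigma(a)=-a\}$. Representations are unital $*$-representations on nonzero Hilbert spaces. *)

theory Defs
  imports "HOL-Analysis.Analysis" "HOL-Algebra.Ring"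
begin

section \<open>Unital C*-algebras\<close>

record 'a star_algebra = "'a ring" +
  scale :: "complex \<Rightarrow> 'a \<Rightarrow> 'a"
  star :: "'a \<Rightarrow> 'a"
  nrm :: "'a \<Rightarrow> real"

locale cstar_algebra = ring A for A :: "'a star_algebra" (structure) +
  assumes scale_closed: "x \<in> carrier A \<Longrightarrow> scale A c x \<in> carrier A"
    and scale_add_right: "\<lbrakk>x \<in> carrier A; y \<in> carrier A\<rbrakk> \<Longrightarrow>
          scale A c (x \<oplus> y) = scale A c x \<oplus> scale A c y"
    and scale_add_left: "x \<in> carrier A \<Longrightarrow>
          scale A (c + d) x = scale A c x \<oplus> scale A d x"
    and scale_scale: "x \<in> carrier A \<Longrightarrow> scale A c (scale A d x) = scale A (c * d) x"
    and scale_one: "x \<in> carrier A \<Longrightarrow> scale A 1 x = x"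
    and scale_mult_left: "\<lbrakk>x \<in> carrier A; y \<in> carrier A\<rbrakk> \<Longrightarrow>
          scale A c x \<otimes> y = scale A c (x \<otimes> y)"
    and scale_mult_right: "\<lbrakk>x \<in> carrier A; y \<in> carrier A\<rbrakk> \<Longrightarrow>
          x \<otimes> scale A c y = scale A c (x \<otimes> y)"
    and star_closed: "x \<in> carrier A \<Longrightarrow> star A x \<in> carrier A"
    and star_add: "\<lbrakk>x \<in> carrier A; y \<in> carrier A\<rbrakk> \<Longrightarrow>
          star A (x \<oplus> y) = star A x \<oplus> star A y"
    and star_scale: "x \<in> carrier A \<Longrightarrow> star A (scale A c x) = scale A (cnj c) (star A x)"
    and star_mult: "\<lbrakk>x \<in> carrier A; y \<in> carrier A\<rbrakk> \<Longrightarrow>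
          star A (x \<otimes> y) = star A y \<otimes> star A x"
    and star_star: "x \<in> carrier A \<Longrightarrow> star A (star A x) = x"
    and nrm_nonneg: "x \<in> carrier A \<Longrightarrow> 0 \<le> nrm A x"
    and nrm_eq_zero: "x \<in> carrier A \<Longrightarrow> nrm A x = 0 \<longleftrightarrow> x = \<zero>"
    and nrm_triangle: "\<lbrakk>x \<in> carrier A; y \<in> carrier A\<rbrakk> \<Longrightarrow>
          nrm A (x \<oplus> y) \<le> nrm A x + nrm A y"
    and nrm_scale: "x \<in> carrier A \<Longrightarrow> nrm A (scale A c x) = cmod c * nrm A x"
    and nrm_mult: "\<lbrakk>x \<in> carrier A; y \<in> carrier A\<rbrakk> \<Longrightarrow>
          nrm A (x \<otimes> y) \<le> nrm A x * nrm A y"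
    and cstar_identity: "x \<in> carrier A \<Longrightarrow> nrm A (star A x \<otimes> x) = (nrm A x)\<^sup>2"
    and complete: "\<lbrakk>\<And>n::nat. s n \<in> carrier A;
          \<And>e. e > 0 \<Longrightarrow> \<exists>N. \<forall>m\<ge>N. \<forall>n\<ge>N. nrm A (s m \<ominus> s n) < e\<rbrakk> \<Longrightarrow>
          \<exists>l\<in>carrier A. (\<lambda>n. nrm A (s n \<ominus> l)) \<longlonglongrightarrow> 0"

definition cstar_subalgebra :: "'a set \<Rightarrow> 'a star_algebra \<Rightarrow> bool" where
  "cstar_subalgebra D B \<longleftrightarrow>
     D \<subseteq> carrier B \<and> \<one>\<^bsub>B\<^esub> \<in> D \<and>
     (\<forall>x\<in>D. \<forall>y\<in>D. x \<oplus>\<^bsub>B\<^esub> y \<in> D \<and> x \<otimes>\<^bsub>B\<^esub> y \<in> D) \<and>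
     (\<forall>c. \<forall>x\<in>D. scale B c x \<in> D) \<and>
     (\<forall>x\<in>D. star B x \<in> D) \<and>
     (\<forall>s l. (\<forall>n::nat. s n \<in> D) \<and> l \<in> carrier B \<and>
            (\<lambda>n. nrm B (s n \<ominus>\<^bsub>B\<^esub> l)) \<longlonglongrightarrow> 0 \<longrightarrow> l \<in> D)"

definition cstar_generates :: "'a set \<Rightarrow> 'a star_algebra \<Rightarrow> bool" where
  "cstar_generates S B \<longleftrightarrow>
     S \<subseteq> carrier B \<and> (\<forall>D. cstar_subalgebra D B \<and> S \<subseteq> D \<longrightarrow> D = carrier B)"

definition star_morphism :: "'a star_algebra \<Rightarrow> 'b star_algebra \<Rightarrow> ('a \<Rightarrow> 'b) \<Rightarrow> bool" where
  "star_morphism A B \<phi> \<longleftrightarrow>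
     (\<forall>x\<in>carrier A. \<phi> x \<in> carrier B) \<and>
     \<phi> \<one>\<^bsub>A\<^esub> = \<one>\<^bsub>B\<^esub> \<and>
     (\<forall>x\<in>carrier A. \<forall>y\<in>carrier A. \<phi> (x \<oplus>\<^bsub>A\<^esub> y) = \<phi> x \<oplus>\<^bsub>B\<^esub> \<phi> y) \<and>
     (\<forall>x\<in>carrier A. \<forall>y\<in>carrier A. \<phi> (x \<otimes>\<^bsub>A\<^esub> y) = \<phi> x \<otimes>\<^bsub>B\<^esub> \<phi> y) \<and>
     (\<forall>c. \<forall>x\<in>carrier A. \<phi> (scale A c x) = scale B c (\<phi> x)) \<and>
     (\<forall>x\<in>carrier A. \<phi> (star A x) = star B (\<phi> x))"

definition order_two_automorphism :: "'a star_algebra \<Rightarrow> ('a \<Rightarrow> 'a) \<Rightarrow> bool" where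
  "order_two_automorphism A \<sigma> \<longleftrightarrow>
     star_morphism A A \<sigma> \<and> bij_betw \<sigma> (carrier A) (carrier A) \<and>
     (\<forall>a\<in>carrier A. \<sigma> (\<sigma> a) = a) \<and> (\<exists>a\<in>carrier A. \<sigma> a \<noteq> a)"

definition fixed_algebra :: "'a star_algebra \<Rightarrow> ('a \<Rightarrow> 'a) \<Rightarrow> 'a star_algebra" where
  "fixed_algebra A \<sigma> = A\<lparr>carrier := {a \<in> carrier A. \<sigma> a = a}\<rparr>"

definition odd_part :: "'a star_algebra \<Rightarrow> ('a \<Rightarrow> 'a) \<Rightarrow> 'a set" where
  "odd_part A \<sigma> = {a \<in> carrier A. \<sigma> a = \<ominus>\<^bsub>A\<^esub> a}"


section \<open>Crossed products by order-two automorphisms\<close>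

definition covariant_unitary ::
  "'a star_algebra \<Rightarrow> ('a \<Rightarrow> 'a) \<Rightarrow> 'b star_algebra \<Rightarrow> ('a \<Rightarrow> 'b) \<Rightarrow> 'b \<Rightarrow> bool" where
  "covariant_unitary A \<sigma> B \<psi> u \<longleftrightarrow>
     u \<in> carrier B \<and>
     star B u \<otimes>\<^bsub>B\<^esub> u = \<one>\<^bsub>B\<^esub> \<and> u \<otimes>\<^bsub>B\<^esub> star B u = \<one>\<^bsub>B\<^esub> \<and>
     u \<otimes>\<^bsub>B\<^esub> u = \<one>\<^bsub>B\<^esub> \<and>
     (\<forall>a\<in>carrier A. u \<otimes>\<^bsub>B\<^esub> \<psi> a \<otimes>\<^bsub>B\<^esub> star B u = \<psi> (\<sigma> a))"

text \<open>
  \<open>B\<close>, with the canonical inclusion \<open>\<iota>\<close> of \<open>A\<close> as a C*-subalgebra (hence isometric) and the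
  canonical unitary \<open>W\<close>, is the crossed product of \<open>A\<close> by \<open>\<sigma>\<close>.

  HOL cannot quantify over types inside a formula, so the test algebras \<open>C\<close> of the universal
  property range over all C*-algebra structures on subsets of the type of \<open>B\<close>. This is no
  restriction: the unital C*-subalgebra of a test algebra generated by \<open>\<psi> A\<close> and \<open>u\<close> is
  \<open>{\<psi> a + \<psi> a' u | a a'. a \<in> A \<and> a' \<in> A}\<close>, whose cardinality is at most that of \<open>A \<times> A\<close> and so
  at most that of \<open>B\<close>; hence it has an isomorphic copy on a subset of that type.
\<close>
definition crossed_product_Z2 ::
  "'a star_algebra \<Rightarrow> ('a \<Rightarrow> 'a) \<Rightarrow> 'b star_algebra \<Rightarrow> ('a \<Rightarrow> 'b) \<Rightarrow> 'b \<Rightarrow> bool" where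
  "crossed_product_Z2 A \<sigma> B \<iota> W \<longleftrightarrow>
     cstar_algebra B \<and>
     star_morphism A B \<iota> \<and> (\<forall>a\<in>carrier A. nrm B (\<iota> a) = nrm A a) \<and>
     covariant_unitary A \<sigma> B \<iota> W \<and>
     cstar_generates (\<iota> ` carrier A \<union> {W}) B \<and>
     (\<forall>(C :: 'b star_algebra) \<psi> u.
        cstar_algebra C \<and> star_morphism A C \<psi> \<and> covariant_unitary A \<sigma> C \<psi> u \<longrightarrow>
        (\<exists>!\<phi>. \<phi> \<in> extensional (carrier B) \<and> star_morphism B C \<phi> \<and>
              (\<forall>a\<in>carrier A. \<phi> (\<iota> a) = \<psi> a) \<and> \<phi> W = u))"


section \<open>Complex Hilbert spaces and operators\<close>

text \<open>The norm, topology and completeness are those of the underlying real Hilbert space; \<open>cinner\<close>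
  is linear in its first argument.\<close>
class complex_hilbert = real_inner + complete_space +
  fixes scaleC :: "complex \<Rightarrow> 'a \<Rightarrow> 'a"
    and cinner :: "'a \<Rightarrow> 'a \<Rightarrow> complex"
  assumes scaleC_of_real: "scaleC (complex_of_real r) x = scaleR r x"
    and scaleC_add_right: "scaleC c (x + y) = scaleC c x + scaleC c y"
    and scaleC_add_left: "scaleC (c + d) x = scaleC c x + scaleC d x"
    and scaleC_scaleC: "scaleC c (scaleC d x) = scaleC (c * d) x"
    and cinner_add_left: "cinner (x + y) z = cinner x z + cinner y z"
    and cinner_scaleC_left: "cinner (scaleC c x) y = c * cinner x y"
    and cinner_commute: "cinner x y = cnj (cinner y x)"
    and inner_eq_Re_cinner: "inner x y = Re (cinner x y)"

definition closed_csubspace :: "'h::complex_hilbert set \<Rightarrow> bool" where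
  "closed_csubspace K \<longleftrightarrow>
     0 \<in> K \<and> (\<forall>x\<in>K. \<forall>y\<in>K. x + y \<in> K) \<and> (\<forall>c. \<forall>x\<in>K. scaleC c x \<in> K) \<and> closed K"

text \<open>Closed subspaces \<open>K\<close> serve as Hilbert spaces in their own right (the whole space being
  \<open>UNIV\<close>); only the values on \<open>K\<close> of an operator on \<open>K\<close> matter.\<close>
definition bounded_operator_on :: "'h::complex_hilbert set \<Rightarrow> ('h \<Rightarrow> 'h) \<Rightarrow> bool" where
  "bounded_operator_on K T \<longleftrightarrow>
     (\<forall>x\<in>K. T x \<in> K) \<and>
     (\<forall>x\<in>K. \<forall>y\<in>K. T (x + y) = T x + T y) \<and>
     (\<forall>c. \<forall>x\<in>K. T (scaleC c x) = scaleC c (T x)) \<and>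
     (\<exists>M. \<forall>x\<in>K. norm (T x) \<le> M * norm x)"

definition operator_spectrum :: "('h::complex_hilbert \<Rightarrow> 'h) \<Rightarrow> complex set" where
  "operator_spectrum T =
     {z. \<not> (\<exists>S. bounded_operator_on UNIV S \<and>
               (\<forall>x. S (T x - scaleC z x) = x) \<and> (\<forall>x. T (S x) - scaleC z (S x) = x))}"

definition eigenspace :: "('h::complex_hilbert \<Rightarrow> 'h) \<Rightarrow> complex \<Rightarrow> 'h set" where
  "eigenspace T z = {x. T x = scaleC z x}"

definition hilbert_direct_sum :: "'h::complex_hilbert set \<Rightarrow> 'h set \<Rightarrow> bool" where
  "hilbert_direct_sum K L \<longleftrightarrow>
     closed_csubspace K \<and> closed_csubspace L \<and>
     (\<forall>x\<in>K. \<forall>y\<in>L. cinner x y = 0) \<and> (\<forall>x. \<exists>y\<in>K. \<exists>z\<in>L. x = y + z)"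

definition orth_proj :: "'h::complex_hilbert set \<Rightarrow> 'h \<Rightarrow> 'h" where
  "orth_proj K x = (THE y. y \<in> K \<and> (\<forall>z\<in>K. cinner (x - y) z = 0))"

text \<open>The matrix entry \<open>L \<rightarrow> K\<close> of an operator, extended by \<open>0\<close> outside \<open>L\<close> so that equality of
  entries is equality of functions.\<close>
definition block :: "'h::complex_hilbert set \<Rightarrow> 'h set \<Rightarrow> ('h \<Rightarrow> 'h) \<Rightarrow> 'h \<Rightarrow> 'h" where
  "block K L T = (\<lambda>x. if x \<in> L then orth_proj K (T x) else 0)"


section \<open>Representations\<close>

definition representation ::
  "'a star_algebra \<Rightarrow> 'h::complex_hilbert set \<Rightarrow> ('a \<Rightarrow> 'h \<Rightarrow> 'h) \<Rightarrow> bool" where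
  "representation A K \<rho> \<longleftrightarrow>
     closed_csubspace K \<and> K \<noteq> {0} \<and>
     (\<forall>a\<in>carrier A. bounded_operator_on K (\<rho> a)) \<and>
     (\<forall>x\<in>K. \<rho> \<one>\<^bsub>A\<^esub> x = x) \<and>
     (\<forall>a\<in>carrier A. \<forall>b\<in>carrier A. \<forall>x\<in>K. \<rho> (a \<oplus>\<^bsub>A\<^esub> b) x = \<rho> a x + \<rho> b x) \<and>
     (\<forall>a\<in>carrier A. \<forall>b\<in>carrier A. \<forall>x\<in>K. \<rho> (a \<otimes>\<^bsub>A\<^esub> b) x = \<rho> a (\<rho> b x)) \<and>
     (\<forall>c. \<forall>a\<in>carrier A. \<forall>x\<in>K. \<rho> (scale A c a) x = scaleC c (\<rho> a x)) \<and>
     (\<forall>a\<in>carrier A. \<forall>x\<in>K. \<forall>y\<in>K. cinner (\<rho> (star A a) x) y = cinner x (\<rho> a y))"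

definition irreducible_representation ::
  "'a star_algebra \<Rightarrow> 'h::complex_hilbert set \<Rightarrow> ('a \<Rightarrow> 'h \<Rightarrow> 'h) \<Rightarrow> bool" where
  "irreducible_representation A K \<rho> \<longleftrightarrow>
     representation A K \<rho> \<and>
     (\<forall>L. closed_csubspace L \<and> L \<subseteq> K \<and> (\<forall>a\<in>carrier A. \<forall>x\<in>L. \<rho> a x \<in> L) \<longrightarrow>
          L = {0} \<or> L = K)"

definition unitarily_equivalent ::
  "'a star_algebra \<Rightarrow> 'h::complex_hilbert set \<Rightarrow> ('a \<Rightarrow> 'h \<Rightarrow> 'h) \<Rightarrow>
   'k::complex_hilbert set \<Rightarrow> ('a \<Rightarrow> 'k \<Rightarrow> 'k) \<Rightarrow> bool" where
  "unitarily_equivalent A K \<rho> L \<tau> \<longleftrightarrow>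
     (\<exists>U. bij_betw U K L \<and>
          (\<forall>x\<in>K. \<forall>y\<in>K. U (x + y) = U x + U y) \<and>
          (\<forall>c. \<forall>x\<in>K. U (scaleC c x) = scaleC c (U x)) \<and>
          (\<forall>x\<in>K. \<forall>y\<in>K. cinner (U x) (U y) = cinner x y) \<and>
          (\<forall>a\<in>carrier A. \<forall>x\<in>K. U (\<rho> a x) = \<tau> a (U x)))"

end

theory Submission
  imports Defs
begin

text \<open>
  The dual automorphism of the crossed product shows that its elements are exactly the \<open>a + b W\<close>
  with \<open>a, b \<in> A\<close>, so an irreducible representation of it amounts to a representation \<open>\<rho>\<close> of \<open>A\<close>
  together with a symmetry \<open>T\<close> that intertwines \<open>\<rho>\<close> and \<open>\<rho> \<circ> \<sigma>\<close>, such that no proper closed subspace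
  is invariant under both. Elements of \<open>A\<^sub>1\<close> preserve the eigenspaces of \<open>T\<close> and elements of
  \<open>A\<^sub>-\<^sub>1\<close> exchange them.

  If \<open>\<rho>\<close> is reducible, with \<open>Q\<close> the projection onto an invariant subspace, Schur's lemma makes
  \<open>Q + T Q T\<close> a scalar, necessarily \<open>1\<close>; then \<open>2 Q - 1\<close> is a unitary that commutes with \<open>\<rho>\<close> and
  exchanges the eigenspaces. Conversely, let \<open>V = U + U\<^sup>*\<close> for an equivalence \<open>U\<close> of the two
  representations of \<open>A\<^sub>1\<close>. Let \<open>G\<close> be the space of vectors that every odd element sends into the
  fixed space of \<open>V\<close>. Applying Schur's lemma to the corners of the projection onto \<open>G\<close> yields a
  scalar \<open>\<zeta>\<close> with \<open>V \<rho>(a) x = \<zeta> \<rho>(a) V x\<close> for odd \<open>a\<close> and \<open>x\<close> in the first eigenspace; the graph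
  of \<open>z V\<close> with \<open>z\<^sup>2 = \<zeta>\<close> is then invariant under \<open>A\<close>.
\<close>

section \<open>Square roots in complete normed rings\<close>

text \<open>Neither functional calculus nor the spectral theorem enters: one iteration, for
  \<open>y = (q + y^2)/2\<close>, is run in a C*-algebra to bound star-morphisms and again among
  bounded operators to obtain \<open>|M|\<close> for Schur's lemma. The delicate direction leads
  from equivalence to reducibility. An equivalence \<open>U\<close> intertwines only the even
  elements, so \<open>V\<close> need not commute with the odd ones and its fixed space need not be
  invariant. Why \<open>G\<close> helps: for odd \<open>a\<close> and \<open>x\<close> in
  \<open>E\<close>, the vector \<open>\<rho> a (x + V x)\<close> lies in \<open>G\<close>, because
  the product of two odd elements is even and \<open>V\<close> commutes with even elements. Its
  components in \<open>E\<close> and \<open>E'\<close> are \<open>\<rho> a (V x)\<close> and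
  \<open>\<rho> a x\<close>, and scalar corners of the projection onto \<open>G\<close> tie the two
  components of every vector of \<open>G\<close> by one fixed scalar. Why a square root: an odd
  element exchanges the two components of a vector in the graph of \<open>z V\<close>, so invariance
  asks that \<open>z V\<close> send \<open>z \<rho> a (V x)\<close> to \<open>\<rho> a x\<close>,
  that is, \<open>z^2 = \<zeta>\<close>.\<close>

text \<open>Common ground of a C*-algebra, whose complex scalars live in the record, and the ring of
  bounded operators with its real scalars: halving is the only scaling that the iteration
  uses.\<close>

locale complete_normed_ring = ring R for R (structure) +
  fixes N :: "'a \<Rightarrow> real" and half :: "'a \<Rightarrow> 'a"
  assumes half_closed: "x \<in> carrier R \<Longrightarrow> half x \<in> carrier R"
    and half_add_half: "x \<in> carrier R \<Longrightarrow> half x \<oplus> half x = x"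
    and half_diff: "\<lbrakk>x \<in> carrier R; y \<in> carrier R\<rbrakk> \<Longrightarrow> half (x \<ominus> y) = half x \<ominus> half y"
    and N_half: "x \<in> carrier R \<Longrightarrow> N (half x) = N x / 2"
    and N_uminus: "x \<in> carrier R \<Longrightarrow> N (\<ominus> x) = N x"
    and N_nonneg: "x \<in> carrier R \<Longrightarrow> 0 \<le> N x"
    and N_eq_0: "x \<in> carrier R \<Longrightarrow> N x = 0 \<longleftrightarrow> x = \<zero>"
    and N_add: "\<lbrakk>x \<in> carrier R; y \<in> carrier R\<rbrakk> \<Longrightarrow> N (x \<oplus> y) \<le> N x + N y"
    and N_mult: "\<lbrakk>x \<in> carrier R; y \<in> carrier R\<rbrakk> \<Longrightarrow> N (x \<otimes> y) \<le> N x * N y"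
    and N_complete: "\<lbrakk>\<And>n::nat. s n \<in> carrier R;
          \<And>e. e > 0 \<Longrightarrow> \<exists>M. \<forall>m\<ge>M. \<forall>n\<ge>M. N (s m \<ominus> s n) < e\<rbrakk> \<Longrightarrow>
          \<exists>l\<in>carrier R. (\<lambda>n. N (s n \<ominus> l)) \<longlonglongrightarrow> 0"
begin

lemma N_diff: "\<lbrakk>x \<in> carrier R; y \<in> carrier R\<rbrakk> \<Longrightarrow> N (x \<ominus> y) \<le> N x + N y"
  by (metis N_add N_uminus a_minus_def a_inv_closed)

lemma N_diff_commute: "\<lbrakk>x \<in> carrier R; y \<in> carrier R\<rbrakk> \<Longrightarrow> N (x \<ominus> y) = N (y \<ominus> x)"
  by (metis N_uminus minus_closed minus_eq minus_add a_comm a_inv_closed minus_minus)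

lemma square_diff:
  assumes "x \<in> carrier R" "y \<in> carrier R"
  shows "x \<otimes> x \<ominus> y \<otimes> y = x \<otimes> (x \<ominus> y) \<oplus> (x \<ominus> y) \<otimes> y"
  using assms by algebra

lemma N_square_diff:
  assumes "x \<in> carrier R" "y \<in> carrier R"
  shows "N (x \<otimes> x \<ominus> y \<otimes> y) \<le> (N x + N y) * N (x \<ominus> y)"
proof -
  have "N (x \<otimes> x \<ominus> y \<otimes> y) \<le> N (x \<otimes> (x \<ominus> y)) + N ((x \<ominus> y) \<otimes> y)"
    unfolding square_diff[OF assms] using assms by (intro N_add) auto
  also have "\<dots> \<le> N x * N (x \<ominus> y) + N (x \<ominus> y) * N y"
    using assms by (intro add_mono N_mult) auto
  finally show ?thesis by (simp add: algebra_simps)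
qed

text \<open>Here \<open>1 - y\<close> is a square root of \<open>1 - q\<close>; stating it for \<open>N q \<le> 1\<close>, not just \<open>N q < 1\<close>, is what
  gives the modulus of a self-adjoint operator.\<close>
lemma half_fixed_point:
  assumes q: "q \<in> carrier R" "N q \<le> 1"
  obtains y t where "y \<in> carrier R" "N y \<le> 1" "y \<oplus> y = q \<oplus> y \<otimes> y"
    "\<And>n. t n \<in> carrier R" "t 0 = \<zero>" "\<And>n. t (Suc n) = half (q \<oplus> t n \<otimes> t n)"
    "(\<lambda>n. N (t n \<ominus> y)) \<longlonglongrightarrow> 0"
proof -
  define y where "y = rec_nat \<zero> (\<lambda>_ x. half (q \<oplus> x \<otimes> x))"
  \<comment> \<open>\<open>s\<close> is the same iteration for the scalar \<open>q = 1\<close>; it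
    increases and stays below 1. It majorises the norms of \<open>y\<close>, and later its
    increments. For \<open>N q = 1\<close> the map need not be a strict contraction, so the Cauchy
    property is taken from this majorant.\<close>
  define s :: "nat \<Rightarrow> real" where "s = rec_nat 0 (\<lambda>_ x. (1 + x\<^sup>2) / 2)"
  have y0: "y 0 = \<zero>" and yS: "y (Suc n) = half (q \<oplus> y n \<otimes> y n)" for n
    by (simp_all add: y_def)
  have s0: "s 0 = 0" and sS: "s (Suc n) = (1 + (s n)\<^sup>2) / 2" for n
    by (simp_all add: s_def)
  have yc: "y n \<in> carrier R" for n
    by (induction n) (auto simp: y0 yS q intro!: half_closed)
  have s_range: "0 \<le> s n \<and> s n \<le> 1" for n
    by (induction n) (auto simp: s0 sS power_le_one)
  have s_inc: "s n \<le> s (Suc n)" for n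
    using sum_power2_ge_zero[of "1 - s n" 0] by (simp add: sS power2_eq_square algebra_simps)
  have "incseq s" using s_inc by (rule incseq_SucI)
  then obtain L where "s \<longlonglongrightarrow> L"
    using incseq_convergent[of s 1] s_range by metis
  then have "Cauchy s" by (rule LIMSEQ_imp_Cauchy)
  have Ny: "N (y n) \<le> s n" for n
  proof (induction n)
    case 0 then show ?case using N_eq_0[of "\<zero>"] by (simp add: y0 s0)
  next
    case (Suc n)
    have "N (q \<oplus> y n \<otimes> y n) \<le> N q + N (y n) * N (y n)"
      using N_add[of q "y n \<otimes> y n"] N_mult[of "y n" "y n"] yc q by fastforce
    also have "\<dots> \<le> 1 + s n * s n"
      using q Suc N_nonneg[OF yc[of n]] by (intro add_mono mult_mono) (auto simp: s_range)
    finally show ?case using N_half[of "q \<oplus> y n \<otimes> y n"] yc q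
      by (simp add: yS sS power2_eq_square)
  qed
  have Nd: "n \<le> m \<Longrightarrow> N (y m \<ominus> y n) \<le> s m - s n" for m n
  proof (induction n arbitrary: m)
    case 0
    have "y m \<ominus> \<zero> = y m" using yc[of m] by algebra
    then show ?case using Ny[of m] by (simp add: y0 s0)
  next
    case (Suc n)
    then obtain k where m: "m = Suc k" "n \<le> k" by (metis Suc_le_D Suc_le_mono)
    have "(q \<oplus> y k \<otimes> y k) \<ominus> (q \<oplus> y n \<otimes> y n) = y k \<otimes> y k \<ominus> y n \<otimes> y n"
      using q yc[of k] yc[of n] by algebra
    then have "N (y m \<ominus> y (Suc n)) = N (y k \<otimes> y k \<ominus> y n \<otimes> y n) / 2"
      using q yc by (simp add: m yS flip: half_diff N_half)
    also have "\<dots> \<le> (N (y k) + N (y n)) * N (y k \<ominus> y n) / 2"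
      using N_square_diff[OF yc yc, of k n] by simp
    \<comment> \<open>The bound is exactly \<open>s (Suc k) - s (Suc n)\<close>: the recursion turns
      a factored difference of squares into an increment of \<open>s\<close>.\<close>
    also have "\<dots> \<le> (s k + s n) * (s k - s n) / 2"
      using Ny[of k] Ny[of n] Suc.IH[OF m(2)] s_range[of k] s_range[of n] yc N_nonneg
      by (intro divide_right_mono mult_mono) auto
    finally show ?case by (simp add: m sS power2_eq_square field_simps)
  qed
  have "\<exists>l\<in>carrier R. (\<lambda>n. N (y n \<ominus> l)) \<longlonglongrightarrow> 0"
  proof (rule N_complete[OF yc])
    fix e :: real assume "e > 0"
    then obtain M where M: "\<And>m n. m \<ge> M \<Longrightarrow> n \<ge> M \<Longrightarrow> \<bar>s m - s n\<bar> < e"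
      using \<open>Cauchy s\<close> unfolding Cauchy_def dist_real_def by meson
    have "N (y m \<ominus> y n) < e" if "m \<ge> M" "n \<ge> M" for m n
    proof (cases "n \<le> m")
      case True then show ?thesis using Nd[of n m] M[OF that] by simp
    next
      case False then show ?thesis
        using Nd[of m n] M[OF that] N_diff_commute[OF yc yc, of m n] by simp
    qed
    then show "\<exists>M. \<forall>m\<ge>M. \<forall>n\<ge>M. N (y m \<ominus> y n) < e" by blast
  qed
  then obtain l where l: "l \<in> carrier R" "(\<lambda>n. N (y n \<ominus> l)) \<longlonglongrightarrow> 0" by blast
  have Nl: "N l \<le> 1"
  proof -
    have *: "N l \<le> 1 + N (y n \<ominus> l)" for n
    proof -
      have "l = y n \<ominus> (y n \<ominus> l)" using yc[of n] l by algebra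
      then have "N l \<le> N (y n) + N (y n \<ominus> l)"
        using N_diff[of "y n" "y n \<ominus> l"] yc[of n] l by auto
      then show ?thesis using Ny[of n] s_range[of n] by linarith
    qed
    have "(\<lambda>n. 1 + N (y n \<ominus> l)) \<longlonglongrightarrow> 1 + 0" by (intro tendsto_intros l)
    from LIMSEQ_le_const[OF this] * show ?thesis by simp
  qed
  have eq: "l \<oplus> l = q \<oplus> l \<otimes> l"
  proof -
    let ?d = "(l \<oplus> l) \<ominus> (q \<oplus> l \<otimes> l)"
    have *: "N ?d \<le> 2 * N (y (Suc n) \<ominus> l) + 2 * N (y n \<ominus> l)" for n
    proof -
      have 1: "y (Suc n) \<oplus> y (Suc n) = q \<oplus> y n \<otimes> y n"
        unfolding yS using q yc by (intro half_add_half) auto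
      \<comment> \<open>By the recursion the second difference is twice
        \<open>y (Suc n) \<ominus> l\<close>, so both parts tend to 0.\<close>
      have "?d = (y n \<otimes> y n \<ominus> l \<otimes> l) \<ominus> ((q \<oplus> y n \<otimes> y n) \<ominus> (l \<oplus> l))"
        using yc[of n] l(1) q(1) by algebra
      also have "\<dots> = (y n \<otimes> y n \<ominus> l \<otimes> l) \<ominus> ((y (Suc n) \<ominus> l) \<oplus> (y (Suc n) \<ominus> l))"
        unfolding 1[symmetric] using yc[of n] yc[of "Suc n"] l(1) by algebra
      finally have "N ?d \<le> N (y n \<otimes> y n \<ominus> l \<otimes> l) + N ((y (Suc n) \<ominus> l) \<oplus> (y (Suc n) \<ominus> l))"
        using N_diff[of "y n \<otimes> y n \<ominus> l \<otimes> l" "(y (Suc n) \<ominus> l) \<oplus> (y (Suc n) \<ominus> l)"] yc l(1) by simp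
      also have "\<dots> \<le> (N (y n) + N l) * N (y n \<ominus> l) + (N (y (Suc n) \<ominus> l) + N (y (Suc n) \<ominus> l))"
        using yc l(1) by (intro add_mono N_square_diff N_add) auto
      also have "\<dots> \<le> 2 * N (y n \<ominus> l) + (N (y (Suc n) \<ominus> l) + N (y (Suc n) \<ominus> l))"
        using Nl Ny[of n] s_range[of n] N_nonneg[of "y n \<ominus> l"] yc l
        by (intro add_mono mult_right_mono) auto
      finally show ?thesis by simp
    qed
    have "(\<lambda>n. 2 * N (y (Suc n) \<ominus> l) + 2 * N (y n \<ominus> l)) \<longlonglongrightarrow> 2 * (0::real) + 2 * 0"
      using LIMSEQ_Suc[OF l(2)] l(2) by (intro tendsto_add tendsto_mult tendsto_const)
    from LIMSEQ_le_const[OF this] * have "N ?d \<le> 0" by simp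
    then have "?d = \<zero>" using N_nonneg[of ?d] N_eq_0[of ?d] l q by auto
    moreover have "l \<oplus> l = ?d \<oplus> (q \<oplus> l \<otimes> l)" using l(1) q(1) by algebra
    ultimately show ?thesis using l q by simp
  qed
  show ?thesis by (rule that[OF l(1) Nl eq yc y0 yS l(2)])
qed

lemma limit_unique:
  assumes "\<And>n. s n \<in> carrier R" "l \<in> carrier R" "l' \<in> carrier R"
    and "(\<lambda>n. N (s n \<ominus> l)) \<longlonglongrightarrow> 0" "(\<lambda>n. N (s n \<ominus> l')) \<longlonglongrightarrow> 0"
  shows "l = l'"
proof -
  have *: "N (l \<ominus> l') \<le> N (s n \<ominus> l) + N (s n \<ominus> l')" for n
  proof -
    have "l \<ominus> l' = (s n \<ominus> l') \<ominus> (s n \<ominus> l)" using assms(1)[of n] assms(2,3) by algebra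
    then show ?thesis using N_diff[of "s n \<ominus> l'" "s n \<ominus> l"] assms(1-3) by simp
  qed
  have "(\<lambda>n. N (s n \<ominus> l) + N (s n \<ominus> l')) \<longlonglongrightarrow> 0 + 0" by (intro tendsto_intros assms)
  from LIMSEQ_le_const[OF this] * have "N (l \<ominus> l') \<le> 0" by simp
  then have "l \<ominus> l' = \<zero>" using N_nonneg N_eq_0 assms(2,3) by (metis minus_closed antisym)
  moreover have "l = (l \<ominus> l') \<oplus> l'" using assms(2,3) by algebra
  ultimately show ?thesis using assms(2,3) by simp
qed

lemma limit_dominated:
  assumes "(\<lambda>n. N (s n \<ominus> l)) \<longlonglongrightarrow> 0"
    and "\<And>n. t n \<in> carrier R" "l' \<in> carrier R" "\<And>n. N (t n \<ominus> l') \<le> K * N (s n \<ominus> l)"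
  shows "(\<lambda>n. N (t n \<ominus> l')) \<longlonglongrightarrow> 0"
proof (rule Lim_null_comparison)
  show "\<forall>\<^sub>F n in sequentially. norm (N (t n \<ominus> l')) \<le> K * N (s n \<ominus> l)"
    using assms N_nonneg by (intro always_eventually) auto
  show "(\<lambda>n. K * N (s n \<ominus> l)) \<longlonglongrightarrow> 0" using tendsto_mult_right_zero[OF assms(1)] .
qed

lemma limit_mult_left:
  assumes "(\<lambda>n. N (s n \<ominus> l)) \<longlonglongrightarrow> 0" "\<And>n. s n \<in> carrier R" "l \<in> carrier R" "h \<in> carrier R"
  shows "(\<lambda>n. N (h \<otimes> s n \<ominus> h \<otimes> l)) \<longlonglongrightarrow> 0"
proof (rule limit_dominated[OF assms(1)])
  fix n
  have "h \<otimes> s n \<ominus> h \<otimes> l = h \<otimes> (s n \<ominus> l)" using assms(2)[of n] assms(3,4) by algebra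
  then show "N (h \<otimes> s n \<ominus> h \<otimes> l) \<le> N h * N (s n \<ominus> l)"
    using N_mult assms by simp
qed (use assms in auto)

lemma limit_mult_right:
  assumes "(\<lambda>n. N (s n \<ominus> l)) \<longlonglongrightarrow> 0" "\<And>n. s n \<in> carrier R" "l \<in> carrier R" "h \<in> carrier R"
  shows "(\<lambda>n. N (s n \<otimes> h \<ominus> l \<otimes> h)) \<longlonglongrightarrow> 0"
proof (rule limit_dominated[OF assms(1)])
  fix n
  have "s n \<otimes> h \<ominus> l \<otimes> h = (s n \<ominus> l) \<otimes> h" using assms(2)[of n] assms(3,4) by algebra
  then show "N (s n \<otimes> h \<ominus> l \<otimes> h) \<le> N h * N (s n \<ominus> l)"
    using N_mult[of "s n \<ominus> l" h] assms by (simp add: mult.commute)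
qed (use assms in auto)

end

section \<open>C*-algebras and crossed products\<close>

context cstar_algebra
begin

lemma scale_zero_right: "scale A c \<zero> = \<zero>"
  using scale_add_right[of "\<zero>" "\<zero>" c] scale_closed[of "\<zero>" c] by simp

lemma scale_uminus: "x \<in> carrier A \<Longrightarrow> scale A c (\<ominus> x) = \<ominus> scale A c x"
  using scale_add_right[of x "\<ominus> x" c] scale_zero_right scale_closed
  by (metis a_inv_closed minus_equality minus_minus r_neg)

lemma scale_diff: "\<lbrakk>x \<in> carrier A; y \<in> carrier A\<rbrakk> \<Longrightarrow> scale A c (x \<ominus> y) = scale A c x \<ominus> scale A c y"
  by (simp add: a_minus_def scale_add_right scale_uminus)

lemma scale_zero_left: "x \<in> carrier A \<Longrightarrow> scale A 0 x = \<zero>"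
  using scale_add_left[of x 0 0] scale_closed[of x 0] by simp

lemma scale_uminus_one: "x \<in> carrier A \<Longrightarrow> scale A (-1) x = \<ominus> x"
  using scale_add_left[of x "-1" 1] scale_zero_left[of x] scale_one[of x] scale_closed
  by (metis add.left_inverse minus_equality)

lemma scale_two: "x \<in> carrier A \<Longrightarrow> scale A 2 x = x \<oplus> x"
  using scale_add_left[of x 1 1] by (simp add: scale_one)

lemma nrm_uminus: "x \<in> carrier A \<Longrightarrow> nrm A (\<ominus> x) = nrm A x"
  using nrm_scale[of x "-1"] by (simp add: scale_uminus_one)

lemma half_add: "x \<in> carrier A \<Longrightarrow> scale A (1/2) x \<oplus> scale A (1/2) x = x"
  using scale_add_left[of x "1/2" "1/2"] by (simp add: scale_one)

sublocale complete_normed_ring A "nrm A" "scale A (1/2)"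
  by unfold_locales
    (auto simp: scale_closed half_add scale_diff nrm_scale nrm_uminus nrm_nonneg nrm_eq_zero
      nrm_triangle nrm_mult complete norm_divide)

lemma star_one: "star A \<one> = \<one>"
  by (metis one_closed star_closed star_star star_mult l_one r_one)

lemma star_uminus: "x \<in> carrier A \<Longrightarrow> star A (\<ominus> x) = \<ominus> star A x"
  using star_scale[of x "-1"] by (simp add: scale_uminus_one star_closed)

lemma star_diff: "\<lbrakk>x \<in> carrier A; y \<in> carrier A\<rbrakk> \<Longrightarrow> star A (x \<ominus> y) = star A x \<ominus> star A y"
  by (simp add: a_minus_def star_add star_uminus)

text \<open>The C*-identity and submultiplicativity give
  \<open>nrm A x \<le> nrm A (star A x)\<close>; the reverse is the same bound for
  \<open>star A x\<close>.\<close>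

lemma nrm_star: "x \<in> carrier A \<Longrightarrow> nrm A (star A x) = nrm A x"
proof -
  have le: "nrm A x \<le> nrm A (star A x)" if "x \<in> carrier A" for x
    using cstar_identity[OF that] nrm_mult[of "star A x" x] nrm_nonneg[of x]
      nrm_nonneg[of "star A x"] star_closed that
    by (cases "nrm A x = 0") (auto simp: power2_eq_square)
  show "x \<in> carrier A \<Longrightarrow> ?thesis" using le[of x] le[of "star A x"] by (simp add: star_closed star_star)
qed

lemma nrm_one_le: "nrm A \<one> \<le> 1"
  using cstar_identity[of \<one>] star_one by (auto simp: power2_eq_square)

text \<open>The unitary is \<open>h + i \<surd>(1 - h\<^sup>2)\<close>.\<close>
lemma self_adjoint_contraction_unitary:
  assumes h: "h \<in> carrier A" "star A h = h" "nrm A h \<le> 1"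
  shows "\<exists>v\<in>carrier A. star A v \<otimes> v = \<one> \<and> v \<oplus> star A v = h \<oplus> h"
proof -
  have hh: "nrm A (h \<otimes> h) \<le> 1"
    using nrm_mult[of h h] h mult_le_one[of "nrm A h" "nrm A h"] nrm_nonneg by fastforce
  obtain y t where y: "y \<in> carrier A" "nrm A y \<le> 1" "y \<oplus> y = h \<otimes> h \<oplus> y \<otimes> y"
    and t: "\<And>n. t n \<in> carrier A" "t 0 = \<zero>"
      "\<And>n. t (Suc n) = scale A (1/2) (h \<otimes> h \<oplus> t n \<otimes> t n)"
    and lim: "(\<lambda>n. nrm A (t n \<ominus> y)) \<longlonglongrightarrow> 0"
    by (rule half_fixed_point[OF m_closed[OF h(1) h(1)] hh]) (rule that)
  \<comment> \<open>Self-adjointness and commutation with \<open>h\<close> hold for every iterate,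
    starting from 0, and reach \<open>y\<close> by uniqueness of limits. This is why the iterates
    are exported together with \<open>y\<close>.\<close>
  have t_sym: "star A (t n) = t n \<and> h \<otimes> t n = t n \<otimes> h" for n
  proof (induction n)
    case 0
    show ?case using h star_scale[of \<zero> 0] by (simp add: t(2) scale_zero_left star_closed)
  next
    case (Suc n)
    define x where "x = t n"
    have x: "x \<in> carrier A" "star A x = x" "h \<otimes> x = x \<otimes> h" using Suc t(1) by (auto simp: x_def)
    have "h \<otimes> (h \<otimes> h \<oplus> x \<otimes> x) = h \<otimes> h \<otimes> h \<oplus> (h \<otimes> x) \<otimes> x" using h x(1) by (simp add: r_distr m_assoc)
    also have "\<dots> = h \<otimes> h \<otimes> h \<oplus> x \<otimes> (h \<otimes> x)" using h x(1) by (subst x(3)) (simp add: m_assoc)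
    also have "\<dots> = (h \<otimes> h \<oplus> x \<otimes> x) \<otimes> h" unfolding x(3) using h x(1) by (simp add: l_distr m_assoc)
    finally show ?case using h x
      by (simp add: t(3) scale_closed star_scale star_add star_mult scale_mult_left scale_mult_right
            flip: x_def)
  qed
  have "nrm A (t n \<ominus> star A y) = nrm A (t n \<ominus> y)" for n
    using star_diff[OF t(1) y(1), of n] nrm_star[of "t n \<ominus> y"] t(1) y(1) by (simp add: t_sym)
  then have "star A y = y"
    using limit_unique[OF t(1) y(1) star_closed[OF y(1)] lim] lim by simp
  moreover have "h \<otimes> y = y \<otimes> h"
    using limit_unique[of "\<lambda>n. h \<otimes> t n" "h \<otimes> y" "y \<otimes> h"] limit_mult_left[OF lim t(1) y(1) h(1)]
      limit_mult_right[OF lim t(1) y(1) h(1)] t(1) y(1) h(1) by (simp add: t_sym)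
  ultimately have ys: "star A y = y" "h \<otimes> y = y \<otimes> h" by auto
  define k where "k = \<one> \<ominus> y"
  define u where "u = scale A \<i> k"
  have k: "k \<in> carrier A" "star A k = k" using y by (simp_all add: k_def star_diff star_one ys)
  have u: "u \<in> carrier A" using k by (simp add: u_def scale_closed)
  have su: "star A u = \<ominus> u"
    using k by (simp add: u_def star_scale scale_scale scale_closed flip: scale_uminus_one)
  \<comment> \<open>Expand \<open>(1 - y)^2\<close> and replace \<open>2 y\<close> by
    \<open>h^2 + y^2\<close>, the fixed point equation.\<close>
  have kk: "k \<otimes> k = \<one> \<ominus> h \<otimes> h"
  proof -
    have "k \<otimes> k = \<one> \<ominus> (y \<oplus> y) \<oplus> y \<otimes> y"
      using y(1) by (simp add: k_def a_minus_def l_distr r_distr l_minus r_minus minus_add a_ac)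
    also have "\<dots> = \<one> \<ominus> h \<otimes> h" unfolding y(3) using y(1) h(1) by algebra
    finally show ?thesis .
  qed
  have hk: "h \<otimes> k = k \<otimes> h"
  proof -
    have "h \<otimes> k = h \<ominus> h \<otimes> y" using y(1) h(1) by (simp add: k_def a_minus_def r_distr r_minus)
    also have "\<dots> = k \<otimes> h" using y(1) h(1) by (simp add: ys(2) k_def a_minus_def l_distr l_minus)
    finally show ?thesis .
  qed
  have hu: "h \<otimes> u = u \<otimes> h" using h k by (simp add: u_def scale_mult_left scale_mult_right hk)
  have uu: "u \<otimes> u = \<ominus> (k \<otimes> k)"
    using k by (simp add: u_def scale_mult_left scale_mult_right scale_scale scale_closed
        flip: scale_uminus_one)
  have "(h \<ominus> u) \<otimes> (h \<oplus> u) = h \<otimes> h \<ominus> u \<otimes> u \<oplus> (h \<otimes> u \<ominus> u \<otimes> h)"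
    using h(1) u by algebra
  also have "\<dots> = \<one>" unfolding hu uu kk using h(1) u by algebra
  finally have "(h \<ominus> u) \<otimes> (h \<oplus> u) = \<one>" .
  moreover have "star A (h \<oplus> u) = h \<ominus> u" using h u by (simp add: star_add su a_minus_def)
  moreover have "(h \<oplus> u) \<oplus> (h \<ominus> u) = h \<oplus> h" using h(1) u by algebra
  ultimately show ?thesis using h u by (metis a_closed)
qed

end

section \<open>Contractivity of star-morphisms\<close>

text \<open>A self-adjoint contraction is the mean of \<open>v\<close> and \<open>star A v\<close>
  for some \<open>v\<close> with \<open>star A v \<otimes> v = \<one>\<close>. The morphism keeps
  this relation, so the C*-identity bounds the norm of \<open>\<phi> v\<close> by 1, and with it the
  image of the contraction. Scaling covers all self-adjoint elements, and the C*-identity for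
  \<open>star A x \<otimes> x\<close> covers every \<open>x\<close>.\<close>

lemma star_morphism_contractive:
  assumes "cstar_algebra A" "cstar_algebra B" and \<phi>: "star_morphism A B \<phi>" and x: "x \<in> carrier A"
  shows "nrm B (\<phi> x) \<le> nrm A x"
proof -
  interpret A: cstar_algebra A by fact
  interpret B: cstar_algebra B by fact
  have \<phi>c: "a \<in> carrier A \<Longrightarrow> \<phi> a \<in> carrier B"
    and \<phi>1: "\<phi> \<one>\<^bsub>A\<^esub> = \<one>\<^bsub>B\<^esub>"
    and \<phi>a: "a \<in> carrier A \<Longrightarrow> b \<in> carrier A \<Longrightarrow> \<phi> (a \<oplus>\<^bsub>A\<^esub> b) = \<phi> a \<oplus>\<^bsub>B\<^esub> \<phi> b"
    and \<phi>m: "a \<in> carrier A \<Longrightarrow> b \<in> carrier A \<Longrightarrow> \<phi> (a \<otimes>\<^bsub>A\<^esub> b) = \<phi> a \<otimes>\<^bsub>B\<^esub> \<phi> b"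
    and \<phi>sc: "a \<in> carrier A \<Longrightarrow> \<phi> (scale A c a) = scale B c (\<phi> a)"
    and \<phi>st: "a \<in> carrier A \<Longrightarrow> \<phi> (star A a) = star B (\<phi> a)" for a b c
    using \<phi> by (auto simp: star_morphism_def)
  have unit: "nrm B (\<phi> h) \<le> 1" if h: "h \<in> carrier A" "star A h = h" "nrm A h \<le> 1" for h
  proof -
    obtain v where v: "v \<in> carrier A" "star A v \<otimes>\<^bsub>A\<^esub> v = \<one>\<^bsub>A\<^esub>" "v \<oplus>\<^bsub>A\<^esub> star A v = h \<oplus>\<^bsub>A\<^esub> h"
      using A.self_adjoint_contraction_unitary[OF h] by blast
    have "(nrm B (\<phi> v))\<^sup>2 = nrm B \<one>\<^bsub>B\<^esub>"
      using B.cstar_identity[OF \<phi>c[OF v(1)]] \<phi>m[of "star A v" v] \<phi>st[of v] v \<phi>1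
      by (simp add: A.star_closed)
    then have "nrm B (\<phi> v) \<le> 1" using B.nrm_one_le power2_le_imp_le[of "nrm B (\<phi> v)" 1] by simp
    have "2 * nrm B (\<phi> h) = nrm B (\<phi> h \<oplus>\<^bsub>B\<^esub> \<phi> h)"
      using B.nrm_scale[of "\<phi> h" 2] h by (simp add: \<phi>c B.scale_two)
    also have "\<phi> h \<oplus>\<^bsub>B\<^esub> \<phi> h = \<phi> v \<oplus>\<^bsub>B\<^esub> star B (\<phi> v)"
      using v h by (simp add: A.star_closed flip: \<phi>a \<phi>st)
    also have "nrm B \<dots> \<le> nrm B (\<phi> v) + nrm B (\<phi> v)"
      using B.nrm_triangle[of "\<phi> v" "star B (\<phi> v)"] v by (simp add: \<phi>c B.star_closed B.nrm_star)
    finally show ?thesis using \<open>nrm B (\<phi> v) \<le> 1\<close> by simp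
  qed
  have sa: "nrm B (\<phi> h) \<le> nrm A h" if h: "h \<in> carrier A" "star A h = h" for h
  proof (cases "h = \<zero>\<^bsub>A\<^esub>")
    case True
    have "\<phi> h = \<zero>\<^bsub>B\<^esub>"
      using \<phi>sc[OF h(1), of 0] h by (simp add: True A.scale_zero_left B.scale_zero_left \<phi>c A.scale_zero_right)
    then show ?thesis using A.nrm_nonneg[OF h(1)] using B.nrm_eq_zero[of "\<zero>\<^bsub>B\<^esub>"] by simp
  next
    case False
    then have pos: "nrm A h > 0" using A.nrm_nonneg A.nrm_eq_zero h by (metis less_eq_real_def)
    define c :: complex where "c = of_real (1 / nrm A h)"
    have c: "cmod c = 1 / nrm A h" using pos by (simp add: c_def norm_divide)
    have "nrm B (\<phi> (scale A c h)) \<le> 1"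
      using h pos by (intro unit) (auto simp: A.scale_closed A.star_scale A.nrm_scale c, simp add: c_def)
    then show ?thesis using h pos by (simp add: \<phi>sc B.nrm_scale \<phi>c c field_simps)
  qed
  have "(nrm B (\<phi> x))\<^sup>2 = nrm B (\<phi> (star A x \<otimes>\<^bsub>A\<^esub> x))"
    using x by (simp add: \<phi>m \<phi>st B.cstar_identity \<phi>c A.star_closed)
  also have "\<dots> \<le> nrm A (star A x \<otimes>\<^bsub>A\<^esub> x)"
    using x by (intro sa) (auto simp: A.star_mult A.star_closed A.star_star)
  also have "\<dots> = (nrm A x)\<^sup>2" using x by (rule A.cstar_identity)
  finally show ?thesis using A.nrm_nonneg[OF x] by (rule power2_le_imp_le)
qed

section \<open>The form of the elements of the crossed product\<close>

lemma covariant_unitary_star: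
  assumes "cstar_algebra B" "covariant_unitary A \<sigma> B \<psi> u"
  shows "star B u = u"
proof -
  interpret B: cstar_algebra B by fact
  show ?thesis using assms(2) unfolding covariant_unitary_def
    by (metis B.l_one B.m_assoc B.r_one B.star_closed)
qed

lemma covariant_unitary_mult:
  assumes "cstar_algebra B" "covariant_unitary A \<sigma> B \<psi> u" "a \<in> carrier A" "\<psi> a \<in> carrier B"
  shows "u \<otimes>\<^bsub>B\<^esub> \<psi> a = \<psi> (\<sigma> a) \<otimes>\<^bsub>B\<^esub> u"
proof -
  interpret B: cstar_algebra B by fact
  have "\<psi> (\<sigma> a) = u \<otimes>\<^bsub>B\<^esub> \<psi> a \<otimes>\<^bsub>B\<^esub> u" "u \<in> carrier B" "u \<otimes>\<^bsub>B\<^esub> u = \<one>\<^bsub>B\<^esub>"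
    using assms(2,3) covariant_unitary_star[OF assms(1,2)] by (simp_all add: covariant_unitary_def)
  then show ?thesis using assms(4) by (simp add: B.m_assoc)
qed

text \<open>The universal property provides the dual automorphism, which fixes \<open>A\<close> and changes the
  sign of \<open>W\<close>. Averaging over it recovers the coefficients of \<open>a + b W\<close> continuously, so these
  elements form a closed subalgebra.\<close>
lemma crossed_product_Z2_decomposition:
  assumes "cstar_algebra A" and sigma: "order_two_automorphism A \<sigma>"
    and crossed: "crossed_product_Z2 A \<sigma> B \<iota> W" and x: "x \<in> carrier B"
  shows "\<exists>a\<in>carrier A. \<exists>b\<in>carrier A. x = \<iota> a \<oplus>\<^bsub>B\<^esub> \<iota> b \<otimes>\<^bsub>B\<^esub> W"
proof -
  interpret A: cstar_algebra A by fact
  interpret B: cstar_algebra B using crossed by (simp add: crossed_product_Z2_def)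
  have \<iota>_morph: "star_morphism A B \<iota>" and \<iota>_nrm: "\<And>a. a \<in> carrier A \<Longrightarrow> nrm B (\<iota> a) = nrm A a"
    and cov: "covariant_unitary A \<sigma> B \<iota> W" and gen: "cstar_generates (\<iota> ` carrier A \<union> {W}) B"
    using crossed by (auto simp: crossed_product_Z2_def)
  have \<iota>c: "a \<in> carrier A \<Longrightarrow> \<iota> a \<in> carrier B"
    and \<iota>1: "\<iota> \<one>\<^bsub>A\<^esub> = \<one>\<^bsub>B\<^esub>"
    and \<iota>a: "a \<in> carrier A \<Longrightarrow> b \<in> carrier A \<Longrightarrow> \<iota> (a \<oplus>\<^bsub>A\<^esub> b) = \<iota> a \<oplus>\<^bsub>B\<^esub> \<iota> b"
    and \<iota>m: "a \<in> carrier A \<Longrightarrow> b \<in> carrier A \<Longrightarrow> \<iota> (a \<otimes>\<^bsub>A\<^esub> b) = \<iota> a \<otimes>\<^bsub>B\<^esub> \<iota> b"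
    and \<iota>sc: "a \<in> carrier A \<Longrightarrow> \<iota> (scale A c a) = scale B c (\<iota> a)"
    and \<iota>st: "a \<in> carrier A \<Longrightarrow> \<iota> (star A a) = star B (\<iota> a)" for a b c
    using \<iota>_morph by (auto simp: star_morphism_def)
  have \<sigma>c: "a \<in> carrier A \<Longrightarrow> \<sigma> a \<in> carrier A" for a
    using sigma by (auto simp: order_two_automorphism_def star_morphism_def)
  have \<iota>0: "\<iota> \<zero>\<^bsub>A\<^esub> = \<zero>\<^bsub>B\<^esub>"
    using \<iota>sc[of "\<zero>\<^bsub>A\<^esub>" 0] by (simp add: A.scale_zero_left B.scale_zero_left \<iota>c)
  have \<iota>d: "\<iota> (a \<ominus>\<^bsub>A\<^esub> b) = \<iota> a \<ominus>\<^bsub>B\<^esub> \<iota> b" if "a \<in> carrier A" "b \<in> carrier A" for a b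
    using that \<iota>sc[of b "-1"] by (simp add: a_minus_def \<iota>a A.scale_uminus_one B.scale_uminus_one \<iota>c)
  have W: "W \<in> carrier B" and WW: "W \<otimes>\<^bsub>B\<^esub> W = \<one>\<^bsub>B\<^esub>"
    and W_cov: "a \<in> carrier A \<Longrightarrow> W \<otimes>\<^bsub>B\<^esub> \<iota> a \<otimes>\<^bsub>B\<^esub> star B W = \<iota> (\<sigma> a)" for a
    using cov by (auto simp: covariant_unitary_def)
  have sW: "star B W = W" by (rule covariant_unitary_star[OF B.cstar_algebra_axioms cov])
  have W\<iota>: "W \<otimes>\<^bsub>B\<^esub> \<iota> a = \<iota> (\<sigma> a) \<otimes>\<^bsub>B\<^esub> W" if a: "a \<in> carrier A" for a
    by (rule covariant_unitary_mult[OF B.cstar_algebra_axioms cov a \<iota>c[OF a]])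
  \<comment> \<open>The test algebra is \<open>B\<close> itself, which has the type over which the
    universal property ranges.\<close>
  have "covariant_unitary A \<sigma> B \<iota> (\<ominus>\<^bsub>B\<^esub> W)"
    using W WW W_cov \<iota>c \<sigma>c by (simp add: covariant_unitary_def B.star_uminus sW B.l_minus B.r_minus)
  then obtain \<phi> where \<phi>: "star_morphism B B \<phi>" "\<And>a. a \<in> carrier A \<Longrightarrow> \<phi> (\<iota> a) = \<iota> a"
      "\<phi> W = \<ominus>\<^bsub>B\<^esub> W"
    using crossed \<iota>_morph B.cstar_algebra_axioms unfolding crossed_product_Z2_def by metis
  have \<phi>c: "a \<in> carrier B \<Longrightarrow> \<phi> a \<in> carrier B"
    and \<phi>a: "a \<in> carrier B \<Longrightarrow> b \<in> carrier B \<Longrightarrow> \<phi> (a \<oplus>\<^bsub>B\<^esub> b) = \<phi> a \<oplus>\<^bsub>B\<^esub> \<phi> b"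
    and \<phi>m: "a \<in> carrier B \<Longrightarrow> b \<in> carrier B \<Longrightarrow> \<phi> (a \<otimes>\<^bsub>B\<^esub> b) = \<phi> a \<otimes>\<^bsub>B\<^esub> \<phi> b"
    and \<phi>sc: "a \<in> carrier B \<Longrightarrow> \<phi> (scale B c a) = scale B c (\<phi> a)" for a b c
    using \<phi> by (auto simp: star_morphism_def)
  have \<phi>d: "\<phi> (a \<ominus>\<^bsub>B\<^esub> b) = \<phi> a \<ominus>\<^bsub>B\<^esub> \<phi> b" if "a \<in> carrier B" "b \<in> carrier B" for a b
    using that \<phi>sc[of b "-1"] by (simp add: a_minus_def \<phi>a B.scale_uminus_one \<phi>c)
  \<comment> \<open>The conditional expectation onto \<open>\<iota> A\<close>: \<open>W\<close>
    changes sign under \<open>\<phi>\<close>, so averaging drops the \<open>W\<close>-term, and the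
    average of \<open>y \<otimes> W\<close> reads off the other coefficient.\<close>
  define E where "E y = scale B (1/2) (y \<oplus>\<^bsub>B\<^esub> \<phi> y)" for y
  have Ec: "y \<in> carrier B \<Longrightarrow> E y \<in> carrier B" for y
    by (simp add: E_def \<phi>c B.scale_closed)
  have E_limit: "(\<lambda>n. nrm B (E (s n) \<ominus>\<^bsub>B\<^esub> E l)) \<longlonglongrightarrow> 0"
    if s: "\<And>n::nat. s n \<in> carrier B" "l \<in> carrier B" "(\<lambda>n. nrm B (s n \<ominus>\<^bsub>B\<^esub> l)) \<longlonglongrightarrow> 0" for s l
  proof (rule B.limit_dominated[OF s(3)])
    fix n
    let ?d = "s n \<ominus>\<^bsub>B\<^esub> l"
    have "(s n \<oplus>\<^bsub>B\<^esub> \<phi> (s n)) \<ominus>\<^bsub>B\<^esub> (l \<oplus>\<^bsub>B\<^esub> \<phi> l) = ?d \<oplus>\<^bsub>B\<^esub> \<phi> ?d"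
      unfolding \<phi>d[OF s(1,2)] using s(1)[of n] s(2) \<phi>c[OF s(1), of n] \<phi>c[OF s(2)] by algebra
    then have "nrm B (E (s n) \<ominus>\<^bsub>B\<^esub> E l) = nrm B (?d \<oplus>\<^bsub>B\<^esub> \<phi> ?d) / 2"
      using s by (simp add: E_def \<phi>c B.nrm_scale norm_divide flip: B.scale_diff)
    also have "\<dots> \<le> (nrm B ?d + nrm B (\<phi> ?d)) / 2"
      using s by (intro divide_right_mono B.nrm_triangle) (auto intro: \<phi>c)
    \<comment> \<open>Contractivity of \<open>\<phi>\<close> is what makes \<open>E\<close>
      continuous.\<close>
    also have "nrm B (\<phi> ?d) \<le> nrm B ?d"
      using s star_morphism_contractive[OF B.cstar_algebra_axioms B.cstar_algebra_axioms \<phi>(1)] by simp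
    finally show "nrm B (E (s n) \<ominus>\<^bsub>B\<^esub> E l) \<le> 1 * nrm B ?d" by simp
  qed (auto intro: Ec s)
  \<comment> \<open>\<open>\<iota>\<close> is isometric, so a convergent sequence in its range comes
    from a Cauchy sequence in \<open>A\<close>, and completeness of \<open>A\<close> supplies a
    preimage of the limit.\<close>
  have \<iota>_closed: "l \<in> \<iota> ` carrier A"
    if s: "\<And>n::nat. s n \<in> \<iota> ` carrier A" "l \<in> carrier B" "(\<lambda>n. nrm B (s n \<ominus>\<^bsub>B\<^esub> l)) \<longlonglongrightarrow> 0" for s l
  proof -
    obtain a where a: "\<And>n. a n \<in> carrier A" "\<And>n. s n = \<iota> (a n)"
      using s(1) unfolding image_iff by metis
    have "\<exists>k\<in>carrier A. (\<lambda>n. nrm A (a n \<ominus>\<^bsub>A\<^esub> k)) \<longlonglongrightarrow> 0"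
    proof (rule A.complete)
      fix e :: real assume "e > 0"
      then obtain M where M: "\<And>n. n \<ge> M \<Longrightarrow> nrm B (s n \<ominus>\<^bsub>B\<^esub> l) < e / 2"
        using s(3) LIMSEQ_D[OF s(3), of "e / 2"] by force
      have "nrm A (a m \<ominus>\<^bsub>A\<^esub> a n) < e" if mn: "m \<ge> M" "n \<ge> M" for m n
      proof -
        have "s m \<ominus>\<^bsub>B\<^esub> s n = (s m \<ominus>\<^bsub>B\<^esub> l) \<ominus>\<^bsub>B\<^esub> (s n \<ominus>\<^bsub>B\<^esub> l)"
          unfolding a(2) using \<iota>c[OF a(1)[of m]] \<iota>c[OF a(1)[of n]] s(2) by algebra
        then have "nrm B (s m \<ominus>\<^bsub>B\<^esub> s n) \<le> nrm B (s m \<ominus>\<^bsub>B\<^esub> l) + nrm B (s n \<ominus>\<^bsub>B\<^esub> l)"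
          using B.N_diff[of "s m \<ominus>\<^bsub>B\<^esub> l" "s n \<ominus>\<^bsub>B\<^esub> l"] s(2) a \<iota>c by simp
        then show ?thesis
          using M[OF mn(1)] M[OF mn(2)] \<iota>_nrm[of "a m \<ominus>\<^bsub>A\<^esub> a n"] a by (simp add: \<iota>d)
      qed
      then show "\<exists>M. \<forall>m\<ge>M. \<forall>n\<ge>M. nrm A (a m \<ominus>\<^bsub>A\<^esub> a n) < e" by blast
    qed (use a in auto)
    then obtain k where k: "k \<in> carrier A" "(\<lambda>n. nrm A (a n \<ominus>\<^bsub>A\<^esub> k)) \<longlonglongrightarrow> 0" by blast
    have "(\<lambda>n. nrm B (s n \<ominus>\<^bsub>B\<^esub> \<iota> k)) \<longlonglongrightarrow> 0"
      using k(2) \<iota>_nrm[of "a n \<ominus>\<^bsub>A\<^esub> k" for n] a k(1) by (simp flip: \<iota>d)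
    then have "l = \<iota> k" using B.limit_unique[of s l "\<iota> k"] s a k \<iota>c by auto
    then show ?thesis using k by blast
  qed
  define D where "D = {y. \<exists>a\<in>carrier A. \<exists>b\<in>carrier A. y = \<iota> a \<oplus>\<^bsub>B\<^esub> \<iota> b \<otimes>\<^bsub>B\<^esub> W}"
  have DI: "\<iota> a \<oplus>\<^bsub>B\<^esub> \<iota> b \<otimes>\<^bsub>B\<^esub> W \<in> D" if "a \<in> carrier A" "b \<in> carrier A" for a b
    using that by (auto simp: D_def)
  have \<iota>D: "\<iota> a \<in> D" if a: "a \<in> carrier A" for a
    using DI[OF a A.zero_closed] \<iota>c[OF a] W by (simp add: \<iota>0)
  have "W \<in> D" using DI[OF A.zero_closed A.one_closed] W by (simp add: \<iota>0 \<iota>1)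
  have Dc: "D \<subseteq> carrier B" using W \<iota>c by (auto simp: D_def)
  have E\<iota>: "E (\<iota> a \<oplus>\<^bsub>B\<^esub> \<iota> b \<otimes>\<^bsub>B\<^esub> W) = \<iota> a" if a: "a \<in> carrier A" and b: "b \<in> carrier A" for a b
  proof -
    have "(\<iota> a \<oplus>\<^bsub>B\<^esub> \<iota> b \<otimes>\<^bsub>B\<^esub> W) \<oplus>\<^bsub>B\<^esub> (\<iota> a \<oplus>\<^bsub>B\<^esub> \<iota> b \<otimes>\<^bsub>B\<^esub> (\<ominus>\<^bsub>B\<^esub> W)) = \<iota> a \<oplus>\<^bsub>B\<^esub> \<iota> a"
      using \<iota>c[OF a] \<iota>c[OF b] W by algebra
    then show ?thesis using a b W B.half_add[OF \<iota>c[OF a]]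
      by (simp add: E_def \<phi> \<phi>a \<phi>m \<iota>c B.scale_add_right)
  qed
  \<comment> \<open>The second summand is half of \<open>y \<ominus> \<phi> y\<close>. The identity
    holds on all of \<open>B\<close>, hence also for a limit of elements of \<open>D\<close> that is
    not yet known to lie in \<open>D\<close>.\<close>
  have sum2: "y = E y \<oplus>\<^bsub>B\<^esub> E (y \<otimes>\<^bsub>B\<^esub> W) \<otimes>\<^bsub>B\<^esub> W" if y: "y \<in> carrier B" for y
  proof -
    note yc = y \<phi>c[OF y] W
    have "E (y \<otimes>\<^bsub>B\<^esub> W) \<otimes>\<^bsub>B\<^esub> W = scale B (1/2) ((y \<otimes>\<^bsub>B\<^esub> W \<oplus>\<^bsub>B\<^esub> \<phi> y \<otimes>\<^bsub>B\<^esub> (\<ominus>\<^bsub>B\<^esub> W)) \<otimes>\<^bsub>B\<^esub> W)"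
      using yc by (simp add: E_def \<phi>m \<phi> B.scale_mult_left)
    also have "(y \<otimes>\<^bsub>B\<^esub> W \<oplus>\<^bsub>B\<^esub> \<phi> y \<otimes>\<^bsub>B\<^esub> (\<ominus>\<^bsub>B\<^esub> W)) \<otimes>\<^bsub>B\<^esub> W = y \<ominus>\<^bsub>B\<^esub> \<phi> y"
      using yc by (simp add: B.l_distr B.m_assoc B.r_minus B.l_minus WW a_minus_def)
    finally have "E y \<oplus>\<^bsub>B\<^esub> E (y \<otimes>\<^bsub>B\<^esub> W) \<otimes>\<^bsub>B\<^esub> W
        = scale B (1/2) ((y \<oplus>\<^bsub>B\<^esub> \<phi> y) \<oplus>\<^bsub>B\<^esub> (y \<ominus>\<^bsub>B\<^esub> \<phi> y))"
      using yc by (simp add: E_def B.scale_add_right)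
    also have "(y \<oplus>\<^bsub>B\<^esub> \<phi> y) \<oplus>\<^bsub>B\<^esub> (y \<ominus>\<^bsub>B\<^esub> \<phi> y) = y \<oplus>\<^bsub>B\<^esub> y" using yc(1,2) by algebra
    also have "scale B (1/2) (y \<oplus>\<^bsub>B\<^esub> y) = y" using y B.half_add by (simp add: B.scale_add_right)
    finally show ?thesis by simp
  qed
  have "cstar_subalgebra D B"
    unfolding cstar_subalgebra_def
  proof (intro conjI ballI allI impI)
    show "\<one>\<^bsub>B\<^esub> \<in> D" using \<iota>D[of "\<one>\<^bsub>A\<^esub>"] by (simp add: \<iota>1)
    fix y z assume "y \<in> D" "z \<in> D"
    then obtain a b c d where
      y: "a \<in> carrier A" "b \<in> carrier A" "y = \<iota> a \<oplus>\<^bsub>B\<^esub> \<iota> b \<otimes>\<^bsub>B\<^esub> W" and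
      z: "c \<in> carrier A" "d \<in> carrier A" "z = \<iota> c \<oplus>\<^bsub>B\<^esub> \<iota> d \<otimes>\<^bsub>B\<^esub> W"
      unfolding D_def by blast
    have "y \<oplus>\<^bsub>B\<^esub> z = \<iota> (a \<oplus>\<^bsub>A\<^esub> c) \<oplus>\<^bsub>B\<^esub> \<iota> (b \<oplus>\<^bsub>A\<^esub> d) \<otimes>\<^bsub>B\<^esub> W"
      unfolding y(3) z(3) \<iota>a[OF y(1) z(1)] \<iota>a[OF y(2) z(2)]
      using \<iota>c[OF y(1)] \<iota>c[OF y(2)] \<iota>c[OF z(1)] \<iota>c[OF z(2)] W by algebra
    then show "y \<oplus>\<^bsub>B\<^esub> z \<in> D" using DI y z by simp
    have "y \<otimes>\<^bsub>B\<^esub> z = \<iota> a \<otimes>\<^bsub>B\<^esub> \<iota> c \<oplus>\<^bsub>B\<^esub> (\<iota> a \<otimes>\<^bsub>B\<^esub> \<iota> d) \<otimes>\<^bsub>B\<^esub> W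
         \<oplus>\<^bsub>B\<^esub> (\<iota> b \<otimes>\<^bsub>B\<^esub> (W \<otimes>\<^bsub>B\<^esub> \<iota> c) \<oplus>\<^bsub>B\<^esub> \<iota> b \<otimes>\<^bsub>B\<^esub> (W \<otimes>\<^bsub>B\<^esub> \<iota> d) \<otimes>\<^bsub>B\<^esub> W)"
      unfolding y(3) z(3)
      using \<iota>c[OF y(1)] \<iota>c[OF y(2)] \<iota>c[OF z(1)] \<iota>c[OF z(2)] W by algebra
    also have "\<iota> b \<otimes>\<^bsub>B\<^esub> (W \<otimes>\<^bsub>B\<^esub> \<iota> d) \<otimes>\<^bsub>B\<^esub> W = \<iota> b \<otimes>\<^bsub>B\<^esub> \<iota> (\<sigma> d)"
      using y z W \<iota>c \<sigma>c by (simp add: W\<iota> B.m_assoc WW)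
    also have "\<iota> b \<otimes>\<^bsub>B\<^esub> (W \<otimes>\<^bsub>B\<^esub> \<iota> c) = (\<iota> b \<otimes>\<^bsub>B\<^esub> \<iota> (\<sigma> c)) \<otimes>\<^bsub>B\<^esub> W"
      using y z W \<iota>c \<sigma>c by (simp add: W\<iota> B.m_assoc)
    also have "\<iota> a \<otimes>\<^bsub>B\<^esub> \<iota> c \<oplus>\<^bsub>B\<^esub> (\<iota> a \<otimes>\<^bsub>B\<^esub> \<iota> d) \<otimes>\<^bsub>B\<^esub> W
         \<oplus>\<^bsub>B\<^esub> ((\<iota> b \<otimes>\<^bsub>B\<^esub> \<iota> (\<sigma> c)) \<otimes>\<^bsub>B\<^esub> W \<oplus>\<^bsub>B\<^esub> \<iota> b \<otimes>\<^bsub>B\<^esub> \<iota> (\<sigma> d))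
       = (\<iota> a \<otimes>\<^bsub>B\<^esub> \<iota> c \<oplus>\<^bsub>B\<^esub> \<iota> b \<otimes>\<^bsub>B\<^esub> \<iota> (\<sigma> d))
         \<oplus>\<^bsub>B\<^esub> (\<iota> a \<otimes>\<^bsub>B\<^esub> \<iota> d \<oplus>\<^bsub>B\<^esub> \<iota> b \<otimes>\<^bsub>B\<^esub> \<iota> (\<sigma> c)) \<otimes>\<^bsub>B\<^esub> W"
      using \<iota>c[OF y(1)] \<iota>c[OF y(2)] \<iota>c[OF z(1)] \<iota>c[OF z(2)] W
        \<iota>c[OF \<sigma>c[OF z(1)]] \<iota>c[OF \<sigma>c[OF z(2)]] by algebra
    also have "\<dots> = \<iota> (a \<otimes>\<^bsub>A\<^esub> c \<oplus>\<^bsub>A\<^esub> b \<otimes>\<^bsub>A\<^esub> \<sigma> d) \<oplus>\<^bsub>B\<^esub> \<iota> (a \<otimes>\<^bsub>A\<^esub> d \<oplus>\<^bsub>A\<^esub> b \<otimes>\<^bsub>A\<^esub> \<sigma> c) \<otimes>\<^bsub>B\<^esub> W"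
      using y z \<sigma>c by (simp add: \<iota>a \<iota>m)
    finally show "y \<otimes>\<^bsub>B\<^esub> z \<in> D" using y z \<sigma>c DI by simp
  next
    fix c y assume "y \<in> D"
    then obtain a b where y: "a \<in> carrier A" "b \<in> carrier A" "y = \<iota> a \<oplus>\<^bsub>B\<^esub> \<iota> b \<otimes>\<^bsub>B\<^esub> W"
      unfolding D_def by blast
    have "scale B c y = \<iota> (scale A c a) \<oplus>\<^bsub>B\<^esub> \<iota> (scale A c b) \<otimes>\<^bsub>B\<^esub> W"
      using y W by (simp add: \<iota>sc \<iota>c B.scale_add_right B.scale_mult_left)
    then show "scale B c y \<in> D" using y DI by (simp add: A.scale_closed)
    \<comment> \<open>The adjoint of \<open>\<iota> b \<otimes> W\<close> is
      \<open>W \<otimes> \<iota> (star A b)\<close>; moving \<open>W\<close> to the right applies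
      \<open>\<sigma>\<close>.\<close>
    have "star B y = \<iota> (star A a) \<oplus>\<^bsub>B\<^esub> \<iota> (\<sigma> (star A b)) \<otimes>\<^bsub>B\<^esub> W"
      using y W by (simp add: B.star_add B.star_mult \<iota>c sW A.star_closed flip: \<iota>st W\<iota>)
    then show "star B y \<in> D" using y DI \<sigma>c by (simp add: A.star_closed)
  next
    fix s l assume "(\<forall>n::nat. s n \<in> D) \<and> l \<in> carrier B \<and> (\<lambda>n. nrm B (s n \<ominus>\<^bsub>B\<^esub> l)) \<longlonglongrightarrow> 0"
    then have s: "\<And>n. s n \<in> D" and l: "l \<in> carrier B" "(\<lambda>n. nrm B (s n \<ominus>\<^bsub>B\<^esub> l)) \<longlonglongrightarrow> 0" by auto
    have sc: "\<And>n. s n \<in> carrier B" using s Dc by blast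
    have Es: "E y \<in> \<iota> ` carrier A" "E (y \<otimes>\<^bsub>B\<^esub> W) \<in> \<iota> ` carrier A" if "y \<in> D" for y
    proof -
      obtain a b where y: "a \<in> carrier A" "b \<in> carrier A" "y = \<iota> a \<oplus>\<^bsub>B\<^esub> \<iota> b \<otimes>\<^bsub>B\<^esub> W"
        using \<open>y \<in> D\<close> unfolding D_def by blast
      show "E y \<in> \<iota> ` carrier A" using y E\<iota> by simp
      have "y \<otimes>\<^bsub>B\<^esub> W = \<iota> b \<oplus>\<^bsub>B\<^esub> \<iota> a \<otimes>\<^bsub>B\<^esub> W"
        using y W \<iota>c by (simp add: B.l_distr B.m_assoc WW B.a_comm)
      then show "E (y \<otimes>\<^bsub>B\<^esub> W) \<in> \<iota> ` carrier A" using y E\<iota> by simp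
    qed
    have "E l \<in> \<iota> ` carrier A"
      by (rule \<iota>_closed[of "\<lambda>n. E (s n)"]) (auto intro: Es s Ec l E_limit sc)
    moreover have "E (l \<otimes>\<^bsub>B\<^esub> W) \<in> \<iota> ` carrier A"
    proof (rule \<iota>_closed[of "\<lambda>n. E (s n \<otimes>\<^bsub>B\<^esub> W)"])
      show "(\<lambda>n. nrm B (E (s n \<otimes>\<^bsub>B\<^esub> W) \<ominus>\<^bsub>B\<^esub> E (l \<otimes>\<^bsub>B\<^esub> W))) \<longlonglongrightarrow> 0"
        using B.limit_mult_right[OF l(2) sc l(1) W] sc l(1) W
        by (intro E_limit[of "\<lambda>n. s n \<otimes>\<^bsub>B\<^esub> W"]) auto
    qed (use Es s Ec l W in auto)
    ultimately show "l \<in> D" using sum2[OF l(1)] DI by (metis imageE)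
  qed (rule Dc)
  then have "D = carrier B"
    using gen \<open>W \<in> D\<close> \<iota>D unfolding cstar_generates_def by blast
  then show ?thesis using x unfolding D_def by blast
qed

section \<open>Projections and Schur's lemma\<close>

subclass (in complex_hilbert) banach ..

section \<open>Complex scalars over the real inner product\<close>

lemma scaleC_one [simp]: "scaleC 1 x = (x::'h::complex_hilbert)"
  using scaleC_of_real[of 1 x] by simp

lemma scaleC_zero_left [simp]: "scaleC 0 x = (0::'h::complex_hilbert)"
  using scaleC_of_real[of 0 x] by simp

lemma scaleC_minus_one [simp]: "scaleC (-1) x = - (x::'h::complex_hilbert)"
  using scaleC_of_real[of "-1" x] by simp

lemma scaleC_zero_right [simp]: "scaleC c 0 = (0::'h::complex_hilbert)"
  using scaleC_add_right[of c 0 "0::'h"] by simp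

lemma scaleC_minus_right: "scaleC c (- x) = - scaleC c (x::'h::complex_hilbert)"
  using scaleC_add_right[of c x "- x"] by (simp add: eq_neg_iff_add_eq_0 add.commute)

lemma scaleC_diff_right: "scaleC c (x - y) = scaleC c x - scaleC c (y::'h::complex_hilbert)"
  using scaleC_add_right[of c x "- y"] by (simp add: scaleC_minus_right)

lemma scaleC_scaleR: "scaleC c (r *\<^sub>R x) = r *\<^sub>R scaleC c (x::'h::complex_hilbert)"
  by (simp add: scaleC_scaleC mult.commute flip: scaleC_of_real)

lemma cinner_scaleC_right: "cinner x (scaleC c y) = cnj c * cinner x (y::'h::complex_hilbert)"
  by (metis cinner_commute cinner_scaleC_left complex_cnj_mult)

lemma inner_scaleC_left: "inner (scaleC c x) y = inner x (scaleC (cnj c) (y::'h::complex_hilbert))"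
  by (simp add: inner_eq_Re_cinner cinner_scaleC_left cinner_scaleC_right)

text \<open>\<open>Im w = Re (- \<i> * w)\<close> recovers the complex inner product from the real
  one. For complex subspaces and complex-linear maps it therefore suffices to argue with
  \<open>inner\<close>.\<close>

lemma cinner_eq_Complex_inner:
  "cinner x y = Complex (inner x y) (inner (scaleC (- \<i>) x) (y::'h::complex_hilbert))"
  by (simp add: complex_eq_iff inner_eq_Re_cinner cinner_scaleC_left)

lemma norm_scaleC: "norm (scaleC c (x::'h::complex_hilbert)) = cmod c * norm x"
proof -
  have "(norm (scaleC c x))\<^sup>2 = inner x (scaleC (cnj c * c) x)"
    by (simp add: power2_norm_eq_inner inner_scaleC_left scaleC_scaleC)
  also have "cnj c * c = of_real ((cmod c)\<^sup>2)" by (metis complex_norm_square mult.commute)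
  finally have "(norm (scaleC c x))\<^sup>2 = (cmod c * norm x)\<^sup>2"
    by (simp add: scaleC_of_real power2_norm_eq_inner power_mult_distrib)
  then show ?thesis by (rule power2_eq_imp_eq) auto
qed

lemma bounded_linear_scaleC: "bounded_linear (scaleC c :: 'h::complex_hilbert \<Rightarrow> 'h)"
  by (rule bounded_linear_intro[of _ "cmod c"])
    (simp_all add: scaleC_add_right scaleC_scaleR norm_scaleC mult.commute)

lemma bounded_operator_imp_bounded_linear:
  fixes T :: "'h::complex_hilbert \<Rightarrow> 'h"
  assumes "bounded_operator_on UNIV T"
  shows "bounded_linear T"
proof -
  obtain M where "\<And>x. norm (T x) \<le> M * norm x"
    using assms unfolding bounded_operator_on_def by auto
  then show ?thesis
    using assms unfolding bounded_operator_on_def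
    by (intro bounded_linear_intro[of _ M]) (auto simp: mult.commute simp flip: scaleC_of_real)
qed

lemma bounded_operator_on_UNIV:
  "bounded_operator_on UNIV T \<longleftrightarrow>
     bounded_linear T \<and> (\<forall>c x. T (scaleC c x) = scaleC c (T (x::'h::complex_hilbert)))"
proof
  assume "bounded_operator_on UNIV T"
  then show "bounded_linear T \<and> (\<forall>c x. T (scaleC c x) = scaleC c (T x))"
    using bounded_operator_imp_bounded_linear by (auto simp: bounded_operator_on_def)
next
  assume T: "bounded_linear T \<and> (\<forall>c x. T (scaleC c x) = scaleC c (T x))"
  then obtain K where "\<And>x. norm (T x) \<le> norm x * K" using bounded_linear.bounded by blast
  then have "\<exists>M. \<forall>x. norm (T x) \<le> M * norm x" by (metis mult.commute)
  then show "bounded_operator_on UNIV T"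
    using T by (simp add: bounded_operator_on_def linear_simps(1))
qed

lemma closed_csubspaceD:
  fixes K :: "'h::complex_hilbert set"
  assumes "closed_csubspace K"
  shows "0 \<in> K" "x \<in> K \<Longrightarrow> y \<in> K \<Longrightarrow> x + y \<in> K" "x \<in> K \<Longrightarrow> scaleC c x \<in> K" "closed K"
    "x \<in> K \<Longrightarrow> r *\<^sub>R x \<in> K" "x \<in> K \<Longrightarrow> - x \<in> K" "x \<in> K \<Longrightarrow> y \<in> K \<Longrightarrow> x - y \<in> K"
proof -
  show *: "0 \<in> K" "x \<in> K \<Longrightarrow> y \<in> K \<Longrightarrow> x + y \<in> K" "x \<in> K \<Longrightarrow> scaleC c x \<in> K" "closed K" for x y c
    using assms by (auto simp: closed_csubspace_def)
  show "x \<in> K \<Longrightarrow> r *\<^sub>R x \<in> K" for x using *(3)[of x "of_real r"] by (simp add: scaleC_of_real)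
  show **: "x \<in> K \<Longrightarrow> - x \<in> K" for x using *(3)[of x "-1"] by simp
  show "x \<in> K \<Longrightarrow> y \<in> K \<Longrightarrow> x - y \<in> K" using *(2)[of x "- y"] **[of y] by simp
qed

section \<open>Orthogonal projections\<close>

lemma parallelogram:
  fixes a b :: "'h::real_inner"
  shows "(norm (a - b))\<^sup>2 = 2 * (norm a)\<^sup>2 + 2 * (norm b)\<^sup>2 - (norm (a + b))\<^sup>2"
  by (simp add: power2_norm_eq_inner inner_simps inner_commute)

text \<open>A sequence in \<open>K\<close> that minimises the distance to \<open>x\<close> is Cauchy
  by the parallelogram law; its limit \<open>p\<close> is a nearest point, and minimality against
  \<open>p + t z\<close> forces orthogonality.\<close>

lemma orthogonal_decomposition:
  fixes K :: "'h::complex_hilbert set"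
  assumes K: "closed_csubspace K"
  shows "\<exists>p\<in>K. \<forall>z\<in>K. inner (x - p) z = 0"
proof -
  note K' = closed_csubspaceD[OF K]
  define d where "d = Inf ((\<lambda>y. (norm (x - y))\<^sup>2) ` K)"
  have bdd: "bdd_below ((\<lambda>y. (norm (x - y))\<^sup>2) ` K)" by (intro bdd_belowI[of _ 0]) auto
  have dle: "d \<le> (norm (x - y))\<^sup>2" if "y \<in> K" for y
    unfolding d_def using that bdd by (intro cInf_lower) auto
  have "\<exists>y\<in>K. (norm (x - y))\<^sup>2 < d + 1 / Suc n" for n
    using cInf_lessD[of "(\<lambda>y. (norm (x - y))\<^sup>2) ` K" "d + 1 / Suc n"] K'(1) by (auto simp: d_def)
  then obtain y where y: "\<And>n. y n \<in> K" "\<And>n. (norm (x - y n))\<^sup>2 < d + 1 / Suc n" by metis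
  have yd: "(norm (y m - y n))\<^sup>2 \<le> 2 / Suc m + 2 / Suc n" for m n
  proof -
    \<comment> \<open>The midpoint of two nearly optimal points lies in \<open>K\<close>, so its
      squared distance to \<open>x\<close> is at least \<open>d\<close>; the parallelogram law turns
      this into closeness of the two points.\<close>
    have "d \<le> (norm (x - (1/2) *\<^sub>R (y m + y n)))\<^sup>2" by (intro dle K' y)
    also have "x - (1/2) *\<^sub>R (y m + y n) = (1/2) *\<^sub>R ((x - y n) + (x - y m))"
      by (simp add: algebra_simps flip: scaleR_add_left)
    finally have "4 * d \<le> (norm ((x - y n) + (x - y m)))\<^sup>2"
      by (simp add: power_mult_distrib power_divide)
    moreover have "(norm (y m - y n))\<^sup>2
        = 2 * (norm (x - y n))\<^sup>2 + 2 * (norm (x - y m))\<^sup>2 - (norm ((x - y n) + (x - y m)))\<^sup>2"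
      using parallelogram[of "x - y n" "x - y m"] by simp
    ultimately show ?thesis using y(2)[of n] y(2)[of m] by (simp add: algebra_simps)
  qed
  have "Cauchy y"
  proof (rule metric_CauchyI)
    fix e :: real assume e: "e > 0"
    obtain N :: nat where N: "4 / e\<^sup>2 < N" using reals_Archimedean2 by blast
    have "dist (y m) (y n) < e" if "m \<ge> N" "n \<ge> N" for m n
    proof -
      have "4 < e\<^sup>2 * N" using N e by (simp add: field_simps)
      also have "\<dots> \<le> e\<^sup>2 * Suc N" using e by (intro mult_left_mono) auto
      finally have "4 / Suc N < e\<^sup>2" by (simp add: field_simps)
      moreover have "2 / Suc m \<le> 2 / Suc N" "2 / Suc n \<le> 2 / Suc N"
        using that by (auto intro!: divide_left_mono)
      ultimately have "(norm (y m - y n))\<^sup>2 < e\<^sup>2" using yd[of m n] by linarith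
      then show ?thesis using e by (simp add: dist_norm power_less_imp_less_base)
    qed
    then show "\<exists>N. \<forall>m\<ge>N. \<forall>n\<ge>N. dist (y m) (y n) < e" by blast
  qed
  then obtain p where p: "y \<longlonglongrightarrow> p" using Cauchy_convergent convergent_def by blast
  have pK: "p \<in> K" using K'(4) y(1) p closed_sequentially by blast
  have "(\<lambda>n. (norm (x - y n))\<^sup>2) \<longlonglongrightarrow> (norm (x - p))\<^sup>2" by (intro tendsto_intros p)
  moreover have "(\<lambda>n. d + 1 / Suc n) \<longlonglongrightarrow> d"
    using LIMSEQ_inverse_real_of_nat_add[of d] by (simp add: inverse_eq_divide)
  ultimately have pd: "(norm (x - p))\<^sup>2 \<le> d"
    using LIMSEQ_le[of _ "(norm (x - p))\<^sup>2" _ d] y(2) less_imp_le by blast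
  have "inner (x - p) z = 0" if z: "z \<in> K" for z
  proof (cases "z = 0")
    case False
    \<comment> \<open>The value that minimises the squared distance from \<open>x\<close> to
      \<open>p + t z\<close>.\<close>
    define t where "t = inner (x - p) z / inner z z"
    have "d \<le> (norm (x - (p + t *\<^sub>R z)))\<^sup>2" by (intro dle K' pK z)
    also have "\<dots> = (norm (x - p))\<^sup>2 - 2 * t * inner (x - p) z + t\<^sup>2 * inner z z"
      unfolding power2_norm_eq_inner
      by (simp add: inner_simps inner_commute power2_eq_square algebra_simps)
    finally have "2 * t * inner (x - p) z \<le> t\<^sup>2 * inner z z" using pd by simp
    then have "2 * (inner (x - p) z)\<^sup>2 \<le> (inner (x - p) z)\<^sup>2"
      using False by (simp add: t_def power2_eq_square field_simps)
    then show ?thesis by simp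
  qed simp
  then show ?thesis using pK by blast
qed

lemma orthogonal_decomposition_unique:
  fixes K :: "'h::complex_hilbert set"
  assumes "closed_csubspace K" "p \<in> K" "q \<in> K"
    "\<And>z. z \<in> K \<Longrightarrow> inner (x - p) z = 0" "\<And>z. z \<in> K \<Longrightarrow> inner (x - q) z = 0"
  shows "p = q"
proof -
  have "inner (p - q) (p - q) = inner (x - q) (p - q) - inner (x - p) (p - q)"
    by (simp add: inner_simps)
  then show ?thesis using assms closed_csubspaceD(7)[OF assms(1-3)] by simp
qed

text \<open>On a complex subspace, orthogonality for the real inner product already gives orthogonality
  for \<open>cinner\<close>.\<close>
lemma orth_proj_eqI:
  fixes K :: "'h::complex_hilbert set"
  assumes K: "closed_csubspace K" and y: "y \<in> K" "\<And>z. z \<in> K \<Longrightarrow> inner (x - y) z = 0"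
  shows "orth_proj K x = y"
  unfolding orth_proj_def
proof (rule the_equality)
  show "y \<in> K \<and> (\<forall>z\<in>K. cinner (x - y) z = 0)"
    using y closed_csubspaceD(3)[OF K]
    by (auto simp: cinner_eq_Complex_inner inner_scaleC_left complex_eq_iff)
next
  fix p assume p: "p \<in> K \<and> (\<forall>z\<in>K. cinner (x - p) z = 0)"
  then show "p = y"
    using orthogonal_decomposition_unique[OF K, of p y x] y by (simp add: inner_eq_Re_cinner)
qed

lemma
  assumes "closed_csubspace K"
  shows orth_proj_in: "orth_proj K x \<in> K"
    and orth_proj_orthogonal: "z \<in> K \<Longrightarrow> inner (x - orth_proj K x) z = 0"
proof -
  obtain p where "p \<in> K" "\<And>z. z \<in> K \<Longrightarrow> inner (x - p) z = 0"
    using orthogonal_decomposition[OF assms] by blast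
  moreover from this have "orth_proj K x = p" by (rule orth_proj_eqI[OF assms])
  ultimately show "orth_proj K x \<in> K" "z \<in> K \<Longrightarrow> inner (x - orth_proj K x) z = 0"
    by blast+
qed

lemma orth_proj_id: "closed_csubspace K \<Longrightarrow> x \<in> K \<Longrightarrow> orth_proj K x = x"
  by (rule orth_proj_eqI) auto

lemma orth_proj_selfadjoint:
  assumes "closed_csubspace K"
  shows "inner (orth_proj K x) y = inner x (orth_proj K y)"
  using orth_proj_orthogonal[OF assms orth_proj_in[OF assms, of y], of x]
    orth_proj_orthogonal[OF assms orth_proj_in[OF assms, of x], of y]
  by (simp add: inner_diff_left inner_diff_right inner_commute)

text \<open>\<open>S\<close> preserves \<open>K\<close> and, through its adjoint \<open>S'\<close>,
  also the orthogonal complement. The case \<open>S = scaleC c\<close> makes the projection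
  complex-linear.\<close>

lemma orth_proj_commute:
  assumes K: "closed_csubspace K" and S: "bounded_linear S"
    and inv: "\<And>x. x \<in> K \<Longrightarrow> S x \<in> K" "\<And>x. x \<in> K \<Longrightarrow> S' x \<in> K"
    and adj: "\<And>x y. inner (S x) y = inner x (S' y)"
  shows "orth_proj K (S x) = S (orth_proj K x)"
proof (rule orth_proj_eqI[OF K])
  show "S (orth_proj K x) \<in> K" by (intro inv orth_proj_in K)
  fix z assume "z \<in> K"
  then show "inner (S x - S (orth_proj K x)) z = 0"
    using S by (simp add: adj inv orth_proj_orthogonal K flip: linear_simps(2))
qed

lemma orth_proj_scaleC: "closed_csubspace K \<Longrightarrow> orth_proj K (scaleC c x) = scaleC c (orth_proj K x)"
  by (rule orth_proj_commute[where S' = "scaleC (cnj c)"])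
    (auto simp: bounded_linear_scaleC closed_csubspaceD inner_scaleC_left)

lemma orth_proj_norm_le:
  assumes "closed_csubspace K"
  shows "norm (orth_proj K x) \<le> norm x"
proof -
  have "(norm (orth_proj K x))\<^sup>2 = inner x (orth_proj K x)"
    by (simp add: power2_norm_eq_inner orth_proj_selfadjoint assms orth_proj_in orth_proj_id)
  also have "\<dots> \<le> norm x * norm (orth_proj K x)" by (rule norm_cauchy_schwarz)
  finally show ?thesis by (cases "orth_proj K x = 0") (auto simp: power2_eq_square)
qed

lemma bounded_linear_orth_proj:
  assumes K: "closed_csubspace K"
  shows "bounded_linear (orth_proj K)"
proof (rule bounded_linear_intro[of _ 1])
  show "orth_proj K (x + y) = orth_proj K x + orth_proj K y" for x y
  proof (rule orth_proj_eqI[OF K])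
    fix z assume "z \<in> K"
    then have "inner (x - orth_proj K x) z + inner (y - orth_proj K y) z = 0"
      by (simp add: orth_proj_orthogonal K)
    then show "inner (x + y - (orth_proj K x + orth_proj K y)) z = 0" by (simp add: inner_simps)
  qed (intro closed_csubspaceD orth_proj_in K)
  show "orth_proj K (r *\<^sub>R x) = r *\<^sub>R orth_proj K x" for r x
    using orth_proj_scaleC[OF K, of "of_real r" x] by (simp add: scaleC_of_real)
qed (simp add: orth_proj_norm_le K)

section \<open>The ring of bounded operators and the modulus\<close>

text \<open>The operators are only real-linear here; complex linearity of an operator built in this
  ring is recovered as commutation with every \<open>scaleC c\<close>.\<close>

definition blinfun_ring :: "('h::banach \<Rightarrow>\<^sub>L 'h) ring" where
  "blinfun_ring = \<lparr>carrier = UNIV, mult = (o\<^sub>L), one = id_blinfun, zero = 0, add = (+)\<rparr>"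

lemma blinfun_ring_simps [simp]:
  "carrier blinfun_ring = UNIV" "x \<otimes>\<^bsub>blinfun_ring\<^esub> y = x o\<^sub>L y" "\<one>\<^bsub>blinfun_ring\<^esub> = id_blinfun"
  "\<zero>\<^bsub>blinfun_ring\<^esub> = 0" "x \<oplus>\<^bsub>blinfun_ring\<^esub> y = x + y"
  by (simp_all add: blinfun_ring_def)

lemma ring_blinfun_ring: "ring (blinfun_ring :: ('h::banach \<Rightarrow>\<^sub>L 'h) ring)"
proof (rule ringI)
  show "abelian_group (blinfun_ring :: ('h \<Rightarrow>\<^sub>L 'h) ring)"
  proof (rule abelian_groupI)
    fix x assume "x \<in> carrier (blinfun_ring :: ('h \<Rightarrow>\<^sub>L 'h) ring)"
    show "\<exists>y\<in>carrier blinfun_ring. y \<oplus>\<^bsub>blinfun_ring\<^esub> x = \<zero>\<^bsub>blinfun_ring\<^esub>"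
      by (intro bexI[of _ "- x"]) auto
  qed auto
  show "monoid (blinfun_ring :: ('h \<Rightarrow>\<^sub>L 'h) ring)"
    by (rule monoidI) (auto intro: blinfun_eqI)
qed (auto intro: blinfun_eqI simp: blinfun.bilinear_simps)

lemma blinfun_ring_uminus [simp]: "\<ominus>\<^bsub>blinfun_ring\<^esub> x = - x"
proof -
  interpret ring "blinfun_ring :: ('a \<Rightarrow>\<^sub>L 'a) ring" by (rule ring_blinfun_ring)
  show ?thesis using minus_equality[of "- x" x] by simp
qed

lemma blinfun_ring_minus [simp]: "x \<ominus>\<^bsub>blinfun_ring\<^esub> y = x - y"
  by (simp add: a_minus_def)

lemma complete_normed_ring_blinfun:
  "complete_normed_ring blinfun_ring norm (\<lambda>x. x /\<^sub>R 2)"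
proof (intro complete_normed_ring.intro ring_blinfun_ring complete_normed_ring_axioms.intro)
  fix s :: "nat \<Rightarrow> ('a \<Rightarrow>\<^sub>L 'a)"
  assume "\<And>e. e > 0 \<Longrightarrow> \<exists>M. \<forall>m\<ge>M. \<forall>n\<ge>M. norm (s m \<ominus>\<^bsub>blinfun_ring\<^esub> s n) < e"
  then have "Cauchy s" by (simp add: Cauchy_def dist_norm)
  then obtain l where "s \<longlonglongrightarrow> l" using Cauchy_convergent convergent_def by blast
  then have "(\<lambda>n. norm (s n - l)) \<longlonglongrightarrow> 0" by (simp add: LIM_zero tendsto_norm_zero)
  then show "\<exists>l\<in>carrier blinfun_ring. (\<lambda>n. norm (s n \<ominus>\<^bsub>blinfun_ring\<^esub> l)) \<longlonglongrightarrow> 0" by auto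
qed (auto simp: norm_triangle_ineq norm_blinfun_compose scaleR_diff_right simp flip: scaleR_add_left)

text \<open>\<open>R\<close> plays the role of \<open>|M|\<close>.\<close>
lemma modulus_exists:
  fixes M :: "'h::complex_hilbert \<Rightarrow> 'h"
  assumes M: "bounded_linear M" and sa: "\<And>x y. inner (M x) y = inner x (M y)"
    and le: "\<And>x. norm (M x) \<le> norm x"
  obtains R where "bounded_linear R" "\<And>x. R (R x) = M (M x)" "\<And>x. inner (R x) x = 0 \<Longrightarrow> R x = 0"
    "\<And>s x. bounded_linear s \<Longrightarrow> (\<And>x. M (s x) = s (M x)) \<Longrightarrow> R (s x) = s (R x)"
proof -
  interpret complete_normed_ring "blinfun_ring :: ('h \<Rightarrow>\<^sub>L 'h) ring" norm "\<lambda>x. x /\<^sub>R 2"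
    by (rule complete_normed_ring_blinfun)
  define m where "m = Blinfun M"
  have m: "blinfun_apply m = M" unfolding m_def by (rule bounded_linear_Blinfun_apply[OF M])
  \<comment> \<open>For \<open>q = 1 - M^2\<close> the fixed point equation reads
    \<open>(1 - y)^2 = 1 - q = M^2\<close>, so \<open>1 - y\<close> serves as
    \<open>R\<close>.\<close>
  define q where "q = id_blinfun - (m o\<^sub>L m)"
  have q: "blinfun_apply q x = x - M (M x)" for x
    by (simp add: q_def blinfun.bilinear_simps m)
  have "norm q \<le> 1"
  proof (rule norm_blinfun_bound)
    fix x
    have "(norm (x - M (M x)))\<^sup>2 = (norm x)\<^sup>2 - 2 * (norm (M x))\<^sup>2 + (norm (M (M x)))\<^sup>2"
      by (simp add: power2_norm_eq_inner inner_simps sa inner_commute algebra_simps)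
    also have "\<dots> \<le> (norm x)\<^sup>2"
      using power_mono[OF le[of "M x"] norm_ge_zero, of 2] zero_le_power2[of "norm (M x)"] by linarith
    finally have "norm (x - M (M x)) \<le> norm x" by (rule power2_le_imp_le) simp
    then show "norm (blinfun_apply q x) \<le> 1 * norm x" by (simp add: q)
  qed simp
  then obtain y t where y: "norm y \<le> 1" "y + y = q + (y o\<^sub>L y)"
    and t: "t 0 = 0" "\<And>n. t (Suc n) = (q + (t n o\<^sub>L t n)) /\<^sub>R 2" "(\<lambda>n. norm (t n - y)) \<longlonglongrightarrow> 0"
    by (rule_tac half_fixed_point[of q]) simp_all
  show ?thesis
  proof (rule that[of "blinfun_apply (id_blinfun - y)"])
    show "bounded_linear (blinfun_apply (id_blinfun - y))" by (rule blinfun.bounded_linear_right)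
    fix x
    have "y x + y x = q x + y (y x)" using y(2) by (metis blinfun.add_left blinfun_apply_blinfun_compose)
    then show "(id_blinfun - y) ((id_blinfun - y) x) = M (M x)"
      by (simp add: blinfun.bilinear_simps q algebra_simps)
    have yx: "norm (y x) \<le> norm x"
      using norm_blinfun[of y x] mult_right_mono[OF y(1), of "norm x"] by simp
    \<comment> \<open>This stands in for positivity of \<open>R\<close>: a contraction
      \<open>y\<close> with \<open>inner (y x) x = inner x x\<close> must fix
      \<open>x\<close>.\<close>
    assume "inner ((id_blinfun - y) x) x = 0"
    then have "inner (y x) x = inner x x" by (simp add: blinfun.bilinear_simps inner_simps)
    then have "(norm (x - y x))\<^sup>2 = (norm (y x))\<^sup>2 - (norm x)\<^sup>2"
      by (simp add: power2_norm_eq_inner inner_simps inner_commute)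
    also have "\<dots> \<le> 0" using power_mono[OF yx, of 2] by simp
    finally show "(id_blinfun - y) x = 0" by (simp add: blinfun.bilinear_simps)
  next
    fix s x assume s: "bounded_linear s" and comm: "\<And>x. M (s x) = s (M x)"
    define z where "z = Blinfun s"
    have z: "blinfun_apply z = s" unfolding z_def by (rule bounded_linear_Blinfun_apply[OF s])
    \<comment> \<open>\<open>z\<close> commutes with \<open>q\<close> and so with every iterate;
      continuity of composition carries this to \<open>y\<close>.\<close>
    have "z o\<^sub>L t n = t n o\<^sub>L z" for n
    proof (induction n)
      case (Suc n)
      then have u: "s (t n x) = t n (s x)" for x by (metis blinfun_apply_blinfun_compose z)
      show ?case
        by (rule blinfun_eqI) (simp add: t z blinfun.bilinear_simps q u comm linear_simps[OF s])
    qed (simp add: t)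
    moreover have t_lim: "t \<longlonglongrightarrow> y" using t(3) LIM_zero_iff tendsto_norm_zero_iff by blast
    have "(\<lambda>n. z o\<^sub>L t n) \<longlonglongrightarrow> (z o\<^sub>L y)"
      by (rule bounded_bilinear.tendsto[OF bounded_bilinear_blinfun_compose tendsto_const t_lim])
    moreover have "(\<lambda>n. t n o\<^sub>L z) \<longlonglongrightarrow> (y o\<^sub>L z)"
      by (rule bounded_bilinear.tendsto[OF bounded_bilinear_blinfun_compose t_lim tendsto_const])
    ultimately have "z o\<^sub>L y = y o\<^sub>L z" using LIMSEQ_unique by auto
    then have "s (y x) = y (s x)" by (metis blinfun_apply_blinfun_compose z)
    then show "(id_blinfun - y) (s x) = s ((id_blinfun - y) x)"
      by (simp add: blinfun.bilinear_simps linear_simps[OF s])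
  qed
qed

section \<open>Schur's lemma for self-adjoint operators\<close>

lemma closed_csubspace_kernel:
  fixes F :: "'h::complex_hilbert \<Rightarrow> 'h"
  assumes K: "closed_csubspace K" and F: "bounded_linear F" "\<And>c x. F (scaleC c x) = scaleC c (F x)"
  shows "closed_csubspace {x \<in> K. F x = 0}"
proof -
  have "closed (K \<inter> {x. F x = 0})"
    by (intro closed_Int closed_Collect_eq closed_csubspaceD[OF K] continuous_intros
        linear_continuous_on F)
  then show ?thesis
    using closed_csubspaceD[OF K] F
    by (auto simp: closed_csubspace_def linear_simps[OF F(1)] Collect_conj_eq)
qed

text \<open>Subtracting a multiple of the identity and rescaling, one may assume \<open>\<langle>M e, e\<rangle> = 0\<close> for some
  \<open>e \<noteq> 0\<close>. Invariance of \<open>ker (|M| - M)\<close> forces \<open>M = |M|\<close> or \<open>M = - |M|\<close> on \<open>K\<close>, so \<open>M e = 0\<close> and the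
  invariant subspace \<open>ker M\<close> is everything.\<close>
lemma schur:
  fixes N :: "'h::complex_hilbert \<Rightarrow> 'h"
  assumes K: "closed_csubspace K"
    and N: "bounded_linear N" "\<And>c x. N (scaleC c x) = scaleC c (N x)"
      "\<And>x y. inner (N x) y = inner x (N y)"
    and E: "bounded_linear E" "\<And>x. E x \<in> K" "\<And>x. x \<in> K \<Longrightarrow> E x = x" "\<And>x. N (E x) = E (N x)"
    and S: "\<And>s. s \<in> S \<Longrightarrow> bounded_linear s" "\<And>s x. s \<in> S \<Longrightarrow> N (s x) = s (N x)"
    and irr: "\<And>L. \<lbrakk>closed_csubspace L; L \<subseteq> K; \<And>s x. s \<in> S \<Longrightarrow> x \<in> L \<Longrightarrow> s x \<in> L; L \<noteq> {0}\<rbrakk> \<Longrightarrow> L = K"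
    and SK: "\<And>s x. s \<in> S \<Longrightarrow> x \<in> K \<Longrightarrow> s x \<in> K"
  obtains r :: real where "\<And>x. x \<in> K \<Longrightarrow> N x = r *\<^sub>R x"
proof (cases "K = {0}")
  case True
  then show ?thesis using that[of 0] linear_simps(3)[OF N(1)] by simp
next
  case False
  then obtain e where e: "e \<in> K" "e \<noteq> 0" using closed_csubspaceD(1)[OF K] by blast
  \<comment> \<open>The Rayleigh quotient of \<open>N\<close> at \<open>e\<close>, which makes
    \<open>F e\<close> orthogonal to \<open>e\<close>.\<close>
  define t where "t = inner (N e) e / inner e e"
  define F where "F = (\<lambda>x. N x - t *\<^sub>R x)"
  have F: "bounded_linear F"
    unfolding F_def by (intro bounded_linear_sub N bounded_linear_scaleR_right)
  obtain C where C: "C > 0" "\<And>x. norm (F x) \<le> norm x * C"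
    using bounded_linear.pos_bounded[OF F] by blast
  define M where "M = (\<lambda>x. (1/C) *\<^sub>R F x)"
  have M: "bounded_linear M" unfolding M_def by (rule bounded_linear_compose[OF bounded_linear_scaleR_right F])
  have M_comm: "M (s x) = s (M x)" if "bounded_linear s" "\<And>x. N (s x) = s (N x)" for s x
    by (simp add: M_def F_def that linear_simps[OF that(1)])
  have M_sa: "inner (M x) y = inner x (M y)" for x y
    by (simp add: M_def F_def inner_simps N)
  have M_le: "norm (M x) \<le> norm x" for x
    using C(1) C(2)[of x] by (simp add: M_def field_simps)
  have Me: "inner (M e) e = 0" using e by (simp add: M_def F_def t_def inner_simps)
  obtain R where R: "bounded_linear R" "\<And>x. R (R x) = M (M x)" "\<And>x. inner (R x) x = 0 \<Longrightarrow> R x = 0"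
    "\<And>s x. bounded_linear s \<Longrightarrow> (\<And>x. M (s x) = s (M x)) \<Longrightarrow> R (s x) = s (R x)"
    using modulus_exists[OF M M_sa M_le] by blast
  have MC: "M (scaleC c x) = scaleC c (M x)" for c x
    by (rule M_comm) (auto simp: bounded_linear_scaleC N)
  have RC: "R (scaleC c x) = scaleC c (R x)" for c x
    by (rule R) (auto simp: bounded_linear_scaleC MC)
  \<comment> \<open>\<open>E\<close> is an idempotent with range \<open>K\<close>. Commuting with it
    keeps \<open>M\<close> and \<open>R\<close> inside \<open>K\<close>: from \<open>x = E x\<close>
    follows \<open>M x = E (M x)\<close>.\<close>
  have ME: "M (E x) = E (M x)" for x by (rule M_comm[OF E(1,4)])
  have RE: "R (E x) = E (R x)" for x by (rule R(4)[OF E(1) ME])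
  have MK: "M x \<in> K" and RK: "R x \<in> K" if "x \<in> K" for x
    using ME[of x] RE[of x] E(2)[of "M x"] E(2)[of "R x"] E(3)[OF that] by simp_all
  have MS: "M (s x) = s (M x)" if "s \<in> S" for s x using M_comm S that by blast
  have RS: "R (s x) = s (R x)" if "s \<in> S" for s x using R(4) S MS that by blast
  have RM: "R (M x) = M (R x)" for x by (rule R(4)[OF M]) simp
  have kernel: "{x \<in> K. G x = 0} = {0} \<or> {x \<in> K. G x = 0} = K"
    if G: "bounded_linear G" "\<And>c x. G (scaleC c x) = scaleC c (G x)" "\<And>s x. s \<in> S \<Longrightarrow> G (s x) = s (G x)" for G
  proof -
    have "s x \<in> {x \<in> K. G x = 0}" if "s \<in> S" "x \<in> {x \<in> K. G x = 0}" for s x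
      using that G(3)[of s x] SK[of s x] linear_simps(3)[OF S(1), of s] by simp
    then show ?thesis using irr[of "{x \<in> K. G x = 0}"] closed_csubspace_kernel[OF K G(1,2)] by blast
  qed
  have "{x \<in> K. R x - M x = 0} = {0} \<or> {x \<in> K. R x - M x = 0} = K"
    by (rule kernel) (auto simp: bounded_linear_sub M R(1) RC MC scaleC_diff_right
        RS MS linear_simps(2)[OF S(1)])
  then have "R e = M e \<or> R e = - M e"
  proof
    assume L: "{x \<in> K. R x - M x = 0} = {0}"
    \<comment> \<open>\<open>R\<close> and \<open>M\<close> commute and have the same square, so
      \<open>R - M\<close> kills \<open>R e + M e\<close>.\<close>
    have "R e + M e \<in> {x \<in> K. R x - M x = 0}"
      using e by (simp add: RK MK closed_csubspaceD[OF K] linear_simps[OF M] linear_simps[OF R(1)] R(2) RM)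
    then show ?thesis unfolding L by (simp add: eq_neg_iff_add_eq_0)
  next
    assume "{x \<in> K. R x - M x = 0} = K"
    then show ?thesis using e(1) by auto
  qed
  \<comment> \<open>\<open>M e\<close> is orthogonal to \<open>e\<close>, hence so is
    \<open>R e\<close>, and for \<open>R\<close> this already means \<open>R e = 0\<close>.\<close>
  then have "M e = 0" using R(3)[of e] Me by auto
  moreover have "{x \<in> K. M x = 0} = {0} \<or> {x \<in> K. M x = 0} = K"
    by (rule kernel) (auto simp: M MC MS)
  ultimately have "{x \<in> K. M x = 0} = K" using e by auto
  then have "N x = t *\<^sub>R x" if "x \<in> K" for x
    using that C(1) unfolding M_def F_def by auto
  then show ?thesis by (rule that)
qed

section \<open>Irreducible covariant pairs\<close>

locale covariant_irrep = cstar_algebra A for A :: "'a star_algebra" (structure) +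
  fixes \<sigma> :: "'a \<Rightarrow> 'a" and \<rho> :: "'a \<Rightarrow> 'h::complex_hilbert \<Rightarrow> 'h" and T :: "'h \<Rightarrow> 'h"
  assumes sigma: "order_two_automorphism A \<sigma>"
    and rep: "representation A UNIV \<rho>"
    and T_op: "bounded_operator_on UNIV T"
    and T_T: "T (T x) = x"
    and T_sa: "inner (T x) y = inner x (T y)"
    and T_cov: "a \<in> carrier A \<Longrightarrow> T (\<rho> a x) = \<rho> (\<sigma> a) (T x)"
    and irr: "\<lbrakk>closed_csubspace L; \<And>a x. a \<in> carrier A \<Longrightarrow> x \<in> L \<Longrightarrow> \<rho> a x \<in> L;
        \<And>x. x \<in> L \<Longrightarrow> T x \<in> L; L \<noteq> {0}\<rbrakk> \<Longrightarrow> L = UNIV"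
begin

lemma
  assumes "a \<in> carrier A"
  shows rho_linear: "bounded_linear (\<rho> a)"
    and rho_scaleC: "\<rho> a (scaleC c x) = scaleC c (\<rho> a x)"
    and rho_scale: "\<rho> (scale A c a) x = scaleC c (\<rho> a x)"
    and rho_adjoint: "inner (\<rho> a x) y = inner x (\<rho> (star A a) y)"
    and rho_plus: "b \<in> carrier A \<Longrightarrow> \<rho> (a \<oplus> b) x = \<rho> a x + \<rho> b x"
    and rho_mult: "b \<in> carrier A \<Longrightarrow> \<rho> (a \<otimes> b) x = \<rho> a (\<rho> b x)"
  using rep assms star_star[OF assms]
  by (auto simp: representation_def bounded_operator_on_UNIV inner_eq_Re_cinner star_closed)
    (metis star_closed)

lemma rho_one: "\<rho> \<one> x = x"
  using rep by (simp add: representation_def)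

lemma rho_uminus: "a \<in> carrier A \<Longrightarrow> \<rho> (\<ominus> a) x = - \<rho> a x"
  using rho_scale[of a "-1" x] by (simp add: scale_uminus_one)

lemma
  shows sigma_closed: "a \<in> carrier A \<Longrightarrow> \<sigma> a \<in> carrier A"
    and sigma_sigma: "a \<in> carrier A \<Longrightarrow> \<sigma> (\<sigma> a) = a"
    and sigma_add: "a \<in> carrier A \<Longrightarrow> b \<in> carrier A \<Longrightarrow> \<sigma> (a \<oplus> b) = \<sigma> a \<oplus> \<sigma> b"
    and sigma_mult: "a \<in> carrier A \<Longrightarrow> b \<in> carrier A \<Longrightarrow> \<sigma> (a \<otimes> b) = \<sigma> a \<otimes> \<sigma> b"
    and sigma_scale: "a \<in> carrier A \<Longrightarrow> \<sigma> (scale A c a) = scale A c (\<sigma> a)"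
    and sigma_star: "a \<in> carrier A \<Longrightarrow> \<sigma> (star A a) = star A (\<sigma> a)"
    and sigma_one: "\<sigma> \<one> = \<one>"
  using sigma by (auto simp: order_two_automorphism_def star_morphism_def)

lemma sigma_uminus: "a \<in> carrier A \<Longrightarrow> \<sigma> (\<ominus> a) = \<ominus> \<sigma> a"
  using sigma_scale[of a "-1"] by (simp add: scale_uminus_one sigma_closed)

lemma T_linear: "bounded_linear T" and T_scaleC: "T (scaleC c x) = scaleC c (T x)"
  using T_op by (auto simp: bounded_operator_on_UNIV)

text \<open>The sign change exchanges the two eigenspaces, so what is proved for \<open>E\<close>
  transfers to \<open>E'\<close>.\<close>

lemma uminus_T: "covariant_irrep A \<sigma> \<rho> (\<lambda>x. - T x)"
proof unfold_locales
  show "bounded_operator_on UNIV (\<lambda>x. - T x)"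
    by (simp add: bounded_operator_on_UNIV bounded_linear_minus T_linear T_scaleC scaleC_minus_right)
  fix L assume L: "closed_csubspace L" "\<And>a x. a \<in> carrier A \<Longrightarrow> x \<in> L \<Longrightarrow> \<rho> a x \<in> L"
    "\<And>x. x \<in> L \<Longrightarrow> - T x \<in> L" "L \<noteq> {0}"
  show "L = UNIV"
    using irr[OF L(1,2) _ L(4)] closed_csubspaceD(6)[OF L(1) L(3)] by auto
qed (auto simp: sigma rep T_T T_sa T_cov linear_simps[OF T_linear]
    linear_simps[OF rho_linear] sigma_closed)

section \<open>Even and odd elements, eigenspaces of the symmetry\<close>

definition even :: "'a set" where "even = {a \<in> carrier A. \<sigma> a = a}"

definition E :: "'h set" where "E = {x. T x = x}"
definition E' :: "'h set" where "E' = {x. T x = - x}"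
definition P :: "'h \<Rightarrow> 'h" where "P x = (1/2) *\<^sub>R (x + T x)"
definition P' :: "'h \<Rightarrow> 'h" where "P' x = (1/2) *\<^sub>R (x - T x)"

lemma evenD: "a \<in> even \<Longrightarrow> a \<in> carrier A" "a \<in> even \<Longrightarrow> \<sigma> a = a"
  by (auto simp: even_def)

lemma oddD: "a \<in> odd_part A \<sigma> \<Longrightarrow> a \<in> carrier A" "a \<in> odd_part A \<sigma> \<Longrightarrow> \<sigma> a = \<ominus> a"
  by (auto simp: odd_part_def)

lemma even_one: "\<one> \<in> even" by (simp add: even_def sigma_one)

lemma even_star: "a \<in> even \<Longrightarrow> star A a \<in> even"
  by (simp add: even_def sigma_star star_closed)

lemma even_mult: "a \<in> even \<Longrightarrow> b \<in> even \<Longrightarrow> a \<otimes> b \<in> even"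
  by (simp add: even_def sigma_mult)

lemma odd_mult_odd: "a \<in> odd_part A \<sigma> \<Longrightarrow> b \<in> odd_part A \<sigma> \<Longrightarrow> a \<otimes> b \<in> even"
  by (simp add: even_def odd_part_def sigma_mult l_minus r_minus)

lemma odd_mult_even: "a \<in> odd_part A \<sigma> \<Longrightarrow> b \<in> even \<Longrightarrow> a \<otimes> b \<in> odd_part A \<sigma>"
  by (simp add: even_def odd_part_def sigma_mult l_minus)

text \<open>On \<open>E\<close> covariance turns \<open>T (\<rho> a x)\<close> into
  \<open>\<rho> (\<sigma> a) x\<close>, so compressing to \<open>E\<close> averages \<open>a\<close>
  over \<open>\<sigma>\<close>. Hence the compression to \<open>E\<close> of any
  \<open>\<rho> a\<close> is already given by an even element.\<close>

lemma even_odd_split: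
  assumes a: "a \<in> carrier A"
  shows "\<exists>e\<in>even. \<exists>b\<in>odd_part A \<sigma>. (\<forall>x. \<rho> a x = \<rho> e x + \<rho> b x) \<and> (\<forall>x\<in>E. P (\<rho> a x) = \<rho> e x)"
proof (intro bexI conjI allI ballI)
  have s: "\<sigma> a \<in> carrier A" by (rule sigma_closed[OF a])
  let ?e = "scale A (1/2) (a \<oplus> \<sigma> a)" and ?b = "scale A (1/2) (a \<oplus> \<ominus> \<sigma> a)"
  show "?e \<in> even" using a s by (simp add: even_def scale_closed sigma_scale sigma_add sigma_sigma a_comm)
  have "\<ominus> (a \<oplus> \<ominus> \<sigma> a) = \<sigma> a \<oplus> \<ominus> a" using a s by (simp add: minus_add a_comm)
  then show "?b \<in> odd_part A \<sigma>" using a s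
    by (simp add: odd_part_def scale_closed sigma_scale sigma_add sigma_uminus sigma_sigma
        flip: scale_uminus)
  have half: "scaleC (1/2) u = (1/2) *\<^sub>R u" for u :: 'h using scaleC_of_real[of "1/2" u] by simp
  show "\<rho> a x = \<rho> ?e x + \<rho> ?b x" for x
    using a s by (simp add: rho_scale rho_plus rho_uminus half scaleR_add_right scaleR_diff_right
        flip: scaleR_add_left)
  show "P (\<rho> a x) = \<rho> ?e x" if "x \<in> E" for x
    using a s that by (simp add: P_def E_def T_cov rho_scale rho_plus half)
qed

lemma T_even: "a \<in> even \<Longrightarrow> T (\<rho> a x) = \<rho> a (T x)"
  by (simp add: even_def T_cov)

lemma T_odd: "a \<in> odd_part A \<sigma> \<Longrightarrow> T (\<rho> a x) = - \<rho> a (T x)"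
  by (simp add: odd_part_def T_cov rho_uminus)

lemma P_linear: "bounded_linear P" and P'_linear: "bounded_linear P'"
  unfolding P_def[abs_def] P'_def[abs_def]
  by (auto intro!: bounded_linear_compose[OF bounded_linear_scaleR_right] bounded_linear_add
      bounded_linear_sub T_linear)

lemma P_scaleC: "P (scaleC c x) = scaleC c (P x)" and P'_scaleC: "P' (scaleC c x) = scaleC c (P' x)"
  by (simp_all add: P_def P'_def T_scaleC scaleC_scaleR scaleC_add_right scaleC_diff_right)

lemma P_sa: "inner (P x) y = inner x (P y)"
  by (simp add: P_def inner_simps T_sa)

lemma P_in: "P x \<in> E" and P'_in: "P' x \<in> E'"
  by (simp_all add: P_def E_def P'_def E'_def linear_simps[OF T_linear] T_T add.commute
      flip: scaleR_minus_right)

lemma P_id: "x \<in> E \<Longrightarrow> P x = x" and P'_id: "x \<in> E' \<Longrightarrow> P' x = x"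
  and P_zero: "x \<in> E' \<Longrightarrow> P x = 0" and P'_zero: "x \<in> E \<Longrightarrow> P' x = 0"
  by (simp_all add: P_def E_def P'_def E'_def flip: scaleR_2)

lemma P_plus_P': "P x + P' x = x"
  by (simp add: P_def P'_def scaleR_add_right scaleR_diff_right flip: scaleR_add_left)

lemma E_Int_E': "x \<in> E \<Longrightarrow> x \<in> E' \<Longrightarrow> x = 0"
  by (metis P_id P_zero)

lemma closed_E: "closed_csubspace E" and closed_E': "closed_csubspace E'"
proof -
  have U: "closed_csubspace (UNIV :: 'h set)" by (simp add: closed_csubspace_def)
  have "x \<in> E" if "P' x = 0" for x using P_plus_P'[of x] P_in[of x] that by simp
  then have 1: "E = {x \<in> UNIV. P' x = 0}" using P'_zero by blast
  have "x \<in> E'" if "P x = 0" for x using P_plus_P'[of x] P'_in[of x] that by simp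
  then have 2: "E' = {x \<in> UNIV. P x = 0}" using P_zero by blast
  from 1 2 show "closed_csubspace E" "closed_csubspace E'"
    using closed_csubspace_kernel[OF U P_linear P_scaleC] closed_csubspace_kernel[OF U P'_linear P'_scaleC]
    by simp_all
qed

lemma E_E'_orthogonal: "x \<in> E \<Longrightarrow> y \<in> E' \<Longrightarrow> inner x y = 0"
  using P_sa[of x y] by (simp add: P_id P_zero)

lemma orth_proj_E: "orth_proj E x = P x" and orth_proj_E': "orth_proj E' x = P' x"
proof -
  have "x - P x = P' x" "x - P' x = P x" using P_plus_P'[of x] by (simp_all add: algebra_simps)
  then show "orth_proj E x = P x" "orth_proj E' x = P' x"
    using E_E'_orthogonal[OF P_in[of x]] E_E'_orthogonal[OF _ P'_in[of x]] P_in[of x] P'_in[of x]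
    by (auto intro!: orth_proj_eqI closed_E closed_E' simp: inner_commute[of "P' x"])
qed

lemma even_E: "a \<in> even \<Longrightarrow> x \<in> E \<Longrightarrow> \<rho> a x \<in> E"
  and even_E': "a \<in> even \<Longrightarrow> x \<in> E' \<Longrightarrow> \<rho> a x \<in> E'"
  and odd_E: "a \<in> odd_part A \<sigma> \<Longrightarrow> x \<in> E \<Longrightarrow> \<rho> a x \<in> E'"
  and odd_E': "a \<in> odd_part A \<sigma> \<Longrightarrow> x \<in> E' \<Longrightarrow> \<rho> a x \<in> E"
  by (simp_all add: E_def E'_def T_even T_odd linear_simps[OF rho_linear[OF evenD(1)]]
      linear_simps[OF rho_linear[OF oddD(1)]])

lemma P_even: "a \<in> even \<Longrightarrow> P (\<rho> a x) = \<rho> a (P x)"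
  by (simp add: P_def T_even linear_simps[OF rho_linear[OF evenD(1)]])

section \<open>Irreducibility of the diagonal blocks\<close>

lemma closed_preimages:
  assumes "closed_csubspace L" and F: "\<And>i. i \<in> I \<Longrightarrow> bounded_linear (F i)"
    "\<And>i c x. i \<in> I \<Longrightarrow> F i (scaleC c x) = scaleC c (F i x)"
  shows "closed_csubspace {x :: 'h. \<forall>i\<in>I. F i x \<in> (L :: 'h set)}"
proof -
  have "closed (\<Inter>i\<in>I. F i -` L)"
    using closed_csubspaceD(4)[OF assms(1)] linear_continuous_on[OF F(1)]
    by (intro closed_INT ballI closed_vimage) (auto simp: continuous_on_eq_continuous_within)
  moreover have "(\<Inter>i\<in>I. F i -` L) = {x. \<forall>i\<in>I. F i x \<in> L}" by auto
  ultimately show ?thesis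
    using closed_csubspaceD(1-3)[OF assms(1)] F
    by (auto simp: closed_csubspace_def linear_simps[OF F(1)])
qed

text \<open>The vectors all of whose translates under \<open>\<rho>\<close> have their \<open>E\<close>-component in \<open>L\<close> form an
  invariant subspace containing \<open>L\<close>, which is therefore everything.\<close>
lemma even_irreducible:
  assumes L: "closed_csubspace L" "L \<subseteq> E" "\<And>a x. a \<in> even \<Longrightarrow> x \<in> L \<Longrightarrow> \<rho> a x \<in> L" "L \<noteq> {0}"
  shows "L = E"
proof -
  let ?M = "{y. \<forall>a\<in>carrier A. P (\<rho> a y) \<in> L}"
  have LM: "L \<subseteq> ?M"
  proof clarify
    fix x a assume x: "x \<in> L" and a: "a \<in> carrier A"
    obtain e where "e \<in> even" "P (\<rho> a x) = \<rho> e x"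
      using even_odd_split[OF a] subsetD[OF L(2) x] by blast
    then show "P (\<rho> a x) \<in> L" using L(3) x by simp
  qed
  have "?M = UNIV"
  proof (rule irr)
    show "closed_csubspace ?M"
      by (rule closed_preimages[where F = "\<lambda>a y. P (\<rho> a y)", OF L(1)])
        (simp_all add: rho_scaleC P_scaleC bounded_linear_compose[OF P_linear] rho_linear)
    show "\<rho> a x \<in> ?M" if "a \<in> carrier A" "x \<in> ?M" for a x
      using that by (auto simp flip: rho_mult)
    show "T x \<in> ?M" if "x \<in> ?M" for x
    proof clarify
      fix a assume a: "a \<in> carrier A"
      \<comment> \<open>\<open>T\<close> passes \<open>\<rho> a\<close> at the cost of
        \<open>\<sigma>\<close> and is then absorbed by \<open>P\<close>.\<close>
      have "\<rho> a (T x) = T (\<rho> (\<sigma> a) x)" using a by (simp add: T_cov sigma_closed sigma_sigma)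
      then have "P (\<rho> a (T x)) = P (\<rho> (\<sigma> a) x)" by (simp add: P_def T_T add.commute)
      then show "P (\<rho> a (T x)) \<in> L" using that sigma_closed[OF a] by simp
    qed
    show "?M \<noteq> {0}" using LM L(4) closed_csubspaceD(1)[OF L(1)] by blast
  qed
  then have "P (\<rho> \<one> x) \<in> L" for x by blast
  then have "x \<in> L" if "x \<in> E" for x using P_id[OF that] by (simp add: rho_one) metis
  then show ?thesis using L(2) by blast
qed

lemma block_E: "block E E (\<rho> a) = (\<lambda>x. if x \<in> E then P (\<rho> a x) else 0)"
  by (simp add: block_def orth_proj_E fun_eq_iff)

lemma block_even:
  assumes "a \<in> even" "x \<in> E"
  shows "block E E (\<rho> a) x = \<rho> a x"
  using assms by (simp add: block_E P_id even_E)

lemma irreducible_representation_block: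
  assumes "E \<noteq> {0}"
  shows "irreducible_representation (fixed_algebra A \<sigma>) E (\<lambda>a. block E E (\<rho> a))"
proof -
  have [simp]: "carrier (fixed_algebra A \<sigma>) = even" "\<one>\<^bsub>fixed_algebra A \<sigma>\<^esub> = \<one>"
    "x \<oplus>\<^bsub>fixed_algebra A \<sigma>\<^esub> y = x \<oplus> y" "x \<otimes>\<^bsub>fixed_algebra A \<sigma>\<^esub> y = x \<otimes> y"
    "scale (fixed_algebra A \<sigma>) c x = scale A c x" "star (fixed_algebra A \<sigma>) x = star A x" for x y c
    by (simp_all add: fixed_algebra_def even_def)
  have ec: "a \<in> carrier A" if "a \<in> even" for a using that by (rule evenD)
  have ex: "x \<oplus> y \<in> even" "scale A c x \<in> even" if "x \<in> even" "y \<in> even" for x y c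
    using that by (auto simp: even_def sigma_add sigma_scale scale_closed)
  have "bounded_operator_on E (block E E (\<rho> a))" if a: "a \<in> even" for a
  proof -
    obtain K where "\<And>x. norm (\<rho> a x) \<le> norm x * K"
      using bounded_linear.bounded[OF rho_linear[OF ec[OF a]]] by blast
    then have "\<exists>M. \<forall>x\<in>E. norm (block E E (\<rho> a) x) \<le> M * norm x"
      by (intro exI[of _ K]) (simp add: block_even[OF a] mult.commute)
    then show ?thesis
      by (simp add: bounded_operator_on_def block_even a even_E closed_csubspaceD[OF closed_E]
          rho_scaleC ec linear_simps[OF rho_linear[OF ec[OF a]]])
  qed
  moreover have "cinner (\<rho> (star A a) x) y = cinner x (\<rho> a y)" if "a \<in> even" for a x y
    using rep ec[OF that] by (simp add: representation_def)
  ultimately have "representation (fixed_algebra A \<sigma>) E (\<lambda>a. block E E (\<rho> a))"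
    using assms unfolding representation_def
    by (simp add: closed_E block_even even_one even_E even_star even_mult ex rho_one rho_plus
        rho_mult rho_scale ec)
  moreover have "L = {0} \<or> L = E"
    if "closed_csubspace L" "L \<subseteq> E" "\<forall>a\<in>even. \<forall>x\<in>L. block E E (\<rho> a) x \<in> L" for L
    using that even_irreducible[OF that(1,2)] by (metis block_even subsetD)
  ultimately show ?thesis by (simp add: irreducible_representation_def)
qed

section \<open>From an invariant subspace to a symmetry in the commutant\<close>

lemma reducible_imp_symmetry:
  assumes L: "closed_csubspace L" "\<And>a x. a \<in> carrier A \<Longrightarrow> x \<in> L \<Longrightarrow> \<rho> a x \<in> L" "L \<noteq> {0}" "L \<noteq> UNIV"
  obtains V where "bounded_linear V" "\<And>c x. V (scaleC c x) = scaleC c (V x)" "\<And>x. V (V x) = x"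
    "\<And>x y. inner (V x) y = inner x (V y)" "\<And>x. V (T x) = - T (V x)"
    "\<And>a x. a \<in> carrier A \<Longrightarrow> V (\<rho> a x) = \<rho> a (V x)"
proof -
  define Q where "Q = orth_proj L"
  have Q: "bounded_linear Q" and QC: "Q (scaleC c x) = scaleC c (Q x)"
    and Q_sa: "inner (Q x) y = inner x (Q y)" and QL: "Q x \<in> L" and Q_id: "x \<in> L \<Longrightarrow> Q x = x" for c x y
    using L(1) by (simp_all add: Q_def bounded_linear_orth_proj orth_proj_scaleC
        orth_proj_selfadjoint orth_proj_in orth_proj_id)
  have Q\<rho>: "Q (\<rho> a x) = \<rho> a (Q x)" if "a \<in> carrier A" for a x
    unfolding Q_def using that L
    by (intro orth_proj_commute[where S' = "\<rho> (star A a)"]) (auto simp: rho_linear rho_adjoint star_closed)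
  \<comment> \<open>The sum of the conjugates of \<open>Q\<close> under the group generated by
    \<open>T\<close>. It commutes with \<open>T\<close>, and with \<open>\<rho>\<close> because
    conjugation by \<open>T\<close> permutes the operators \<open>\<rho> a\<close>.\<close>
  define D where "D x = Q x + T (Q (T x))" for x
  have D: "bounded_linear D" unfolding D_def[abs_def]
    by (intro bounded_linear_add Q bounded_linear_compose[OF T_linear] bounded_linear_compose[OF Q] T_linear)
  have U: "closed_csubspace (UNIV :: 'h set)" by (simp add: closed_csubspace_def)
  have DT: "D (T x) = T (D x)" for x
    by (simp add: D_def T_T linear_simps(1)[OF T_linear])
  have D\<rho>: "D (\<rho> a x) = \<rho> a (D x)" if a: "a \<in> carrier A" for a x
    using a by (simp add: D_def Q\<rho> T_cov sigma_closed sigma_sigma linear_simps(1)[OF rho_linear[OF a]])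
  obtain r where "\<And>x. x \<in> UNIV \<Longrightarrow> D x = r *\<^sub>R x"
  proof (rule schur[OF U D _ _ bounded_linear_ident, where S = "insert T (\<rho> ` carrier A)"])
    show "D (scaleC c x) = scaleC c (D x)" for c x by (simp add: D_def QC T_scaleC scaleC_add_right)
    show "inner (D x) y = inner x (D y)" for x y by (simp add: D_def inner_simps Q_sa T_sa)
    show "K = UNIV" if "closed_csubspace K" "K \<subseteq> UNIV"
      "\<And>s x. s \<in> insert T (\<rho> ` carrier A) \<Longrightarrow> x \<in> K \<Longrightarrow> s x \<in> K" "K \<noteq> {0}" for K
      using that by (intro irr) auto
  qed (auto simp: T_linear rho_linear DT D\<rho>)
  then have r: "Q x + T (Q (T x)) = r *\<^sub>R x" for x by (simp add: D_def)
  have QT: "Q (T x) = (r - 1) *\<^sub>R T x" if "x \<in> L" for x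
  proof -
    have "T (Q (T x)) = (r - 1) *\<^sub>R x" using r[of x] Q_id[OF that] by (simp add: algebra_simps)
    then have "T (T (Q (T x))) = (r - 1) *\<^sub>R T x" by (simp add: linear_simps[OF T_linear])
    then show ?thesis by (simp add: T_T)
  qed
  obtain v where v: "v \<in> L" "v \<noteq> 0" using L(3) closed_csubspaceD(1)[OF L(1)] by blast
  have "T v \<noteq> 0" using v T_T[of v] linear_simps(3)[OF T_linear] by auto
  \<comment> \<open>\<open>T v\<close> is an eigenvector of the idempotent \<open>Q\<close> for the
    eigenvalue \<open>r - 1\<close>.\<close>
  moreover have "(r - 1) *\<^sub>R (r - 1) *\<^sub>R T v = (r - 1) *\<^sub>R T v"
    using Q_id[OF QL[of "T v"]] by (simp add: QT[OF v(1)] linear_simps[OF Q])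
  ultimately have "r = 1 \<or> r = 2" by auto
  \<comment> \<open>Otherwise \<open>Q\<close> fixes \<open>T x\<close> for every \<open>x\<close>
    in \<open>L\<close>, so \<open>L\<close> is invariant under \<open>T\<close> as well.\<close>
  moreover have "r \<noteq> 2"
  proof
    assume "r = 2"
    then have "T x \<in> L" if "x \<in> L" for x using QT[OF that] QL[of "T x"] by simp
    then show False using irr[OF L(1,2) _ L(3)] L(4) by blast
  qed
  ultimately have "r = 1" by simp
  \<comment> \<open>Conjugation by \<open>T\<close> carries \<open>Q\<close> to
    \<open>1 - Q\<close>, which is anticommutation of \<open>T\<close> with
    \<open>2 Q - 1\<close>.\<close>
  have QT': "Q (T x) = T x - T (Q x)" for x
  proof -
    have "T (Q (T x)) = x - Q x" using r[of x] \<open>r = 1\<close> by (simp add: algebra_simps)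
    then have "T (T (Q (T x))) = T x - T (Q x)" by (simp add: linear_simps[OF T_linear])
    then show ?thesis by (simp add: T_T)
  qed
  show thesis
  proof (rule that[of "\<lambda>x. 2 *\<^sub>R Q x - x"])
    show "bounded_linear (\<lambda>x. 2 *\<^sub>R Q x - x)"
      by (intro bounded_linear_sub bounded_linear_compose[OF bounded_linear_scaleR_right] Q bounded_linear_ident)
    show "2 *\<^sub>R Q (2 *\<^sub>R Q x - x) - (2 *\<^sub>R Q x - x) = x" for x
      by (simp add: linear_simps[OF Q] Q_id[OF QL] scaleR_2)
    show "2 *\<^sub>R Q (T x) - T x = - T (2 *\<^sub>R Q x - x)" for x
      by (simp add: QT' linear_simps[OF T_linear] scaleR_2)
  qed (auto simp: QC scaleC_scaleR scaleC_diff_right inner_simps Q_sa Q\<rho> linear_simps[OF rho_linear])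
qed

lemma uminus_spaces: "covariant_irrep.E (\<lambda>x. - T x) = E'" "covariant_irrep.E' (\<lambda>x. - T x) = E"
  by (auto simp: covariant_irrep.E_def[OF uminus_T] covariant_irrep.E'_def[OF uminus_T] E_def E'_def
      minus_equation_iff)

lemma irreducible_representation_block':
  "E' \<noteq> {0} \<Longrightarrow> irreducible_representation (fixed_algebra A \<sigma>) E' (\<lambda>a. block E' E' (\<rho> a))"
  using covariant_irrep.irreducible_representation_block[OF uminus_T] by (simp add: uminus_spaces)

section \<open>From a symmetry back to an invariant subspace\<close>

text \<open>The vectors of \<open>E\<close> killed by all odd elements are preserved by even
  elements, since odd times even is odd, and by \<open>T\<close>, which fixes \<open>E\<close>. They
  form an invariant subspace inside the proper subspace \<open>E\<close>.\<close>

lemma odd_kernel_trivial: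
  assumes x: "x \<in> E" "\<And>b. b \<in> odd_part A \<sigma> \<Longrightarrow> \<rho> b x = 0" and E: "E \<noteq> UNIV"
  shows "x = 0"
proof (rule ccontr)
  assume "x \<noteq> 0"
  let ?L = "E \<inter> {y. \<forall>b\<in>odd_part A \<sigma>. \<rho> b y \<in> {0}}"
  have 0: "closed_csubspace ({0} :: 'h set)" by (simp add: closed_csubspace_def)
  have "closed_csubspace {y. \<forall>b\<in>odd_part A \<sigma>. \<rho> b y \<in> {0}}"
    by (rule closed_preimages[OF 0]) (simp_all add: rho_linear rho_scaleC oddD)
  then have "closed_csubspace ?L" using closed_E by (auto simp: closed_csubspace_def)
  then have "?L = UNIV"
  proof (rule irr)
    show "\<rho> a y \<in> ?L" if a: "a \<in> carrier A" and y: "y \<in> ?L" for a y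
    proof -
      obtain e b where eb: "e \<in> even" "b \<in> odd_part A \<sigma>" "\<rho> a y = \<rho> e y + \<rho> b y"
        using even_odd_split[OF a] by blast
      then have "\<rho> a y = \<rho> e y" using y by simp
      moreover have "\<rho> c (\<rho> e y) = 0" if "c \<in> odd_part A \<sigma>" for c
        using y odd_mult_even[OF that eb(1)] by (simp flip: rho_mult add: that oddD evenD eb(1))
      ultimately show ?thesis using y even_E[OF eb(1)] by simp
    qed
    show "T y \<in> ?L" if "y \<in> ?L" for y using that by (auto simp: E_def)
    show "?L \<noteq> {0}" using x \<open>x \<noteq> 0\<close> by auto
  qed
  then show False using E by blast
qed

text \<open>\<open>M\<close> may mix \<open>E\<close> and \<open>E'\<close>, but its corner
  \<open>P M P\<close> is self-adjoint and commutes with the even elements, which act irreducibly on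
  \<open>E\<close>.\<close>

lemma schur_E:
  assumes M: "bounded_linear M" "\<And>c x. M (scaleC c x) = scaleC c (M x)"
    "\<And>x y. inner (M x) y = inner x (M y)" "\<And>a x. a \<in> even \<Longrightarrow> M (\<rho> a x) = \<rho> a (M x)"
  shows "\<exists>r. \<forall>x\<in>E. P (M x) = r *\<^sub>R x"
proof -
  obtain r where r: "\<And>x. x \<in> E \<Longrightarrow> P (M (P x)) = r *\<^sub>R x"
  proof (rule schur[OF closed_E, where N = "\<lambda>x. P (M (P x))" and E = P and S = "\<rho> ` even"])
    show "bounded_linear (\<lambda>x. P (M (P x)))"
      by (rule bounded_linear_compose[OF P_linear bounded_linear_compose[OF M(1) P_linear]])
    show "L = E" if L: "closed_csubspace L" "L \<subseteq> E"
      "\<And>s x. s \<in> \<rho> ` even \<Longrightarrow> x \<in> L \<Longrightarrow> s x \<in> L" "L \<noteq> {0}" for L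
      using even_irreducible[OF L(1,2) _ L(4)] L(3) by blast
  qed (auto simp: P_scaleC M P_sa P_linear P_in P_id P_even rho_linear evenD even_E)
  then show ?thesis by (metis P_id)
qed

lemma symmetry_imp_reducible:
  assumes V: "bounded_linear V" "\<And>c x. V (scaleC c x) = scaleC c (V x)" "\<And>x. V (V x) = x"
    and V_sa: "\<And>x y. inner (V x) y = inner x (V y)" and VT: "\<And>x. V (T x) = - T (V x)"
    and V_even: "\<And>a x. a \<in> even \<Longrightarrow> V (\<rho> a x) = \<rho> a (V x)"
    and E: "E \<noteq> {0}"
  obtains L where "closed_csubspace L" "\<And>a x. a \<in> carrier A \<Longrightarrow> x \<in> L \<Longrightarrow> \<rho> a x \<in> L"
    "L \<noteq> {0}" "L \<noteq> UNIV"
proof -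
  note V_simps = linear_simps[OF V(1)]
  have PV: "P (V x) = V (P' x)" and P'V: "P' (V x) = V (P x)" for x
    by (simp_all add: P_def P'_def V_simps VT)
  have VE: "V x \<in> E'" if "x \<in> E" for x using P'_in[of "V x"] by (simp add: P'V P_id that)
  have VE': "V x \<in> E" if "x \<in> E'" for x using P_in[of "V x"] by (simp add: PV P'_id that)
  obtain v where v: "v \<in> E" "v \<noteq> 0" using E closed_csubspaceD(1)[OF closed_E] by blast
  have "V v \<noteq> 0" using v(2) V(3)[of v] V_simps(3) by auto
  have proper: "E \<noteq> UNIV" "E' \<noteq> UNIV"
    using v VE[OF v(1)] \<open>V v \<noteq> 0\<close> E_Int_E' by blast+
  define G where "G = {y. \<forall>b\<in>odd_part A \<sigma>. V (\<rho> b y) - \<rho> b y \<in> {0}}"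
  have GI: "y \<in> G \<longleftrightarrow> (\<forall>b\<in>odd_part A \<sigma>. V (\<rho> b y) = \<rho> b y)" for y by (simp add: G_def)
  have 0: "closed_csubspace ({0} :: 'h set)" by (simp add: closed_csubspace_def)
  have G: "closed_csubspace G" unfolding G_def
    by (rule closed_preimages[OF 0])
      (simp_all add: bounded_linear_sub bounded_linear_compose[OF V(1)] rho_linear rho_scaleC oddD
        V(2) scaleC_diff_right)
  have G_even: "\<rho> e y \<in> G" if e: "e \<in> even" and y: "y \<in> G" for e y
    using y odd_mult_even[OF _ e] by (auto simp: GI oddD evenD e simp flip: rho_mult)
  \<comment> \<open>Odd elements send \<open>y\<close> into \<open>E'\<close>, and \<open>V\<close>
    moves the result to \<open>E\<close>; if \<open>V\<close> also fixes it, it is 0.\<close>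
  have G_E: "y = 0" if y: "y \<in> G" "y \<in> E" for y
  proof (rule odd_kernel_trivial[OF y(2) _ proper(1)])
    fix b assume b: "b \<in> odd_part A \<sigma>"
    have "V (\<rho> b y) \<in> E" using VE'[OF odd_E[OF b y(2)]] .
    then show "\<rho> b y = 0" using E_Int_E' odd_E[OF b y(2)] y(1) b by (auto simp: GI)
  qed
  have G_E': "y = 0" if y: "y \<in> G" "y \<in> E'" for y
  proof (rule covariant_irrep.odd_kernel_trivial[OF uminus_T], unfold uminus_spaces)
    fix b assume b: "b \<in> odd_part A \<sigma>"
    have "V (\<rho> b y) \<in> E'" using VE[OF odd_E'[OF b y(2)]] .
    then show "\<rho> b y = 0" using E_Int_E' odd_E'[OF b y(2)] y(1) b by (auto simp: GI)
  qed (use y proper in auto)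
  define Q where "Q = orth_proj G"
  have Q: "bounded_linear Q" "\<And>c x. Q (scaleC c x) = scaleC c (Q x)"
    and Q_sa: "\<And>x y. inner (Q x) y = inner x (Q y)"
    and QG: "\<And>x. Q x \<in> G" and Q_id: "\<And>x. x \<in> G \<Longrightarrow> Q x = x"
    using G by (simp_all add: Q_def bounded_linear_orth_proj orth_proj_scaleC
        orth_proj_selfadjoint orth_proj_in orth_proj_id)
  note Q_simps = linear_simps[OF Q(1)]
  have Q_even: "Q (\<rho> a x) = \<rho> a (Q x)" if "a \<in> even" for a x
    unfolding Q_def using that G G_even[OF that] G_even[OF even_star[OF that]]
    by (intro orth_proj_commute[where S' = "\<rho> (star A a)"]) (auto simp: rho_linear rho_adjoint evenD)
  obtain p where p: "\<And>x. x \<in> E \<Longrightarrow> P (Q x) = p *\<^sub>R x"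
    using schur_E[OF Q Q_sa Q_even] by blast
  \<comment> \<open>The off-diagonal corner \<open>P Q V\<close> need not be self-adjoint, as
    \<open>schur_E\<close> requires. Its two self-adjoint parts come from \<open>Q V + V Q\<close>
    and \<open>\<i> (Q V - V Q)\<close>, with the scalars \<open>s\<close> and
    \<open>t\<close>.\<close>
  obtain s where s: "\<And>x. x \<in> E \<Longrightarrow> P (Q (V x) + V (Q x)) = s *\<^sub>R x"
  proof -
    have "\<exists>r. \<forall>x\<in>E. P (Q (V x) + V (Q x)) = r *\<^sub>R x"
      by (rule schur_E[where M = "\<lambda>x. Q (V x) + V (Q x)"])
        (simp_all add: bounded_linear_add bounded_linear_compose[OF Q(1) V(1)] bounded_linear_compose[OF V(1) Q(1)]
          Q V(2) scaleC_add_right inner_simps Q_sa V_sa Q_even V_even linear_simps(1)[OF rho_linear] evenD)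
    then show thesis using that by blast
  qed
  obtain t where t: "\<And>x. x \<in> E \<Longrightarrow> P (scaleC \<i> (Q (V x) - V (Q x))) = t *\<^sub>R x"
  proof -
    have "\<exists>r. \<forall>x\<in>E. P (scaleC \<i> (Q (V x) - V (Q x))) = r *\<^sub>R x"
    proof (rule schur_E[where M = "\<lambda>x. scaleC \<i> (Q (V x) - V (Q x))"])
      show "bounded_linear (\<lambda>x. scaleC \<i> (Q (V x) - V (Q x)))"
        by (intro bounded_linear_compose[OF bounded_linear_scaleC] bounded_linear_sub
            bounded_linear_compose[OF Q(1) V(1)] bounded_linear_compose[OF V(1) Q(1)])
      show "inner (scaleC \<i> (Q (V x) - V (Q x))) y = inner x (scaleC \<i> (Q (V y) - V (Q y)))" for x y
      proof -
        have "inner (scaleC \<i> (Q (V x) - V (Q x))) y = inner x (V (Q (scaleC (- \<i>) y)) - Q (V (scaleC (- \<i>) y)))"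
          by (simp add: inner_scaleC_left inner_diff_left inner_diff_right Q_sa V_sa)
        also have "V (Q (scaleC (- \<i>) y)) - Q (V (scaleC (- \<i>) y)) = scaleC (- \<i>) (V (Q y) - Q (V y))"
          by (simp only: Q V scaleC_diff_right)
        also have "\<dots> = scaleC \<i> (Q (V y) - V (Q y))"
          using scaleC_scaleC[of \<i> "-1" "V (Q y) - Q (V y)"] by simp
        finally show ?thesis .
      qed
    qed (simp_all add: Q V(2) scaleC_diff_right scaleC_scaleC mult.commute Q_even V_even
        linear_simps(2)[OF rho_linear] rho_scaleC evenD)
    then show thesis using that by blast
  qed
  \<comment> \<open>Solves \<open>u + w = s x\<close> and \<open>u - w = - \<i> t x\<close> for
    \<open>u = P (Q (V x))\<close>.\<close>
  define c where "c = (of_real s - \<i> * of_real t) / 2"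
  have c: "P (Q (V x)) = scaleC c x" if x: "x \<in> E" for x
  proof -
    define u w where "u = P (Q (V x))" and "w = P (V (Q x))"
    have 1: "u + w = scaleC (of_real s) x"
      using s[OF x] by (simp add: u_def w_def linear_simps[OF P_linear] scaleC_of_real)
    have "scaleC \<i> (u - w) = scaleC (of_real t) x"
      using t[OF x] by (simp add: u_def w_def linear_simps[OF P_linear] P_scaleC scaleC_of_real)
    then have "scaleC (- \<i>) (scaleC \<i> (u - w)) = scaleC (- \<i>) (scaleC (of_real t) x)" by simp
    then have 2: "u - w = scaleC (- \<i> * of_real t) x" by (simp add: scaleC_scaleC)
    have "scaleC 2 u = u + u" using scaleC_of_real[of 2 u] by (simp add: scaleR_2)
    also have "\<dots> = (u + w) + (u - w)" by simp
    also have "\<dots> = scaleC (of_real s + - \<i> * of_real t) x" unfolding 1 2 by (rule scaleC_add_left[symmetric])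
    also have "of_real s + - \<i> * of_real t = 2 * c" by (simp add: c_def)
    finally have "scaleC (1/2) (scaleC 2 u) = scaleC (1/2) (scaleC (2 * c) x)" by simp
    then show ?thesis by (simp add: scaleC_scaleC u_def)
  qed
  \<comment> \<open>Expand \<open>P (Q y)\<close> for \<open>y = Q y\<close>. The component in
    \<open>E'\<close> is \<open>V\<close> of a vector of \<open>E\<close>, so the scalar
    \<open>c\<close> applies to it.\<close>
  have G_eq: "P y = p *\<^sub>R P y + scaleC c (V (P' y))" if y: "y \<in> G" for y
  proof -
    have "P y = P (Q (P y + P' y))" by (simp add: P_plus_P' Q_id y)
    also have "\<dots> = P (Q (P y)) + P (Q (V (V (P' y))))" by (simp add: Q_simps linear_simps[OF P_linear] V)
    also have "\<dots> = p *\<^sub>R P y + scaleC c (V (P' y))" by (simp add: p[OF P_in] c[OF VE'[OF P'_in]])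
    finally show ?thesis .
  qed
  have odd_G: "\<rho> a y \<in> G" if "a \<in> odd_part A \<sigma>" "V y = y" for a y
    using that odd_mult_odd[OF _ that(1)] by (auto simp: GI oddD V_even simp flip: rho_mult)
  \<comment> \<open>With \<open>c = 0\<close> the space \<open>G\<close> would be 0. Odd elements
    map \<open>v + V v\<close> into \<open>G\<close>, so they would kill it, and a vector killed by
    all odd elements lies in \<open>G\<close>.\<close>
  have "c \<noteq> 0"
  proof
    assume "c = 0"
    then have Py: "(1 - p) *\<^sub>R P y = 0" if "y \<in> G" for y
      using G_eq[OF that] by (simp add: scaleR_diff_left scaleC_zero_left)
    \<comment> \<open>For \<open>p = 1\<close> the projection \<open>Q\<close> would preserve the
      length of \<open>v\<close>, placing \<open>v\<close> in \<open>G\<close>.\<close>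
    have "p \<noteq> 1"
    proof
      assume "p = 1"
      then have "P (Q v) = v" using p[OF v(1)] by simp
      then have "inner (Q v) v = inner v v" using P_sa[of "Q v" v] P_id[OF v(1)] by simp
      moreover have "inner (Q v) (Q v) = inner (Q v) v" using Q_sa[of v "Q v"] Q_id[OF QG, of v] by (simp add: Q_sa)
      ultimately have "inner (Q v - v) (Q v - v) = 0" by (simp add: inner_simps inner_commute)
      then have "v \<in> G" using QG[of v] by simp
      then show False using G_E v by blast
    qed
    then have G0: "y = 0" if "y \<in> G" for y
      using G_E'[OF that] Py[OF that] P_plus_P'[of y] P'_in[of y] by simp
    have "V (v + V v) = v + V v" by (simp add: V V_simps add.commute)
    then have "\<rho> b (v + V v) = 0" if "b \<in> odd_part A \<sigma>" for b using G0 odd_G that by blast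
    then have "v + V v \<in> G" by (simp add: GI V_simps(3))
    then have "v + V v = 0" by (rule G0)
    then have "P (v + V v) = 0" by (simp add: linear_simps[OF P_linear])
    then show False using v by (simp add: linear_simps[OF P_linear] P_id P_zero VE)
  qed
  \<comment> \<open>Read off from \<open>(1 - p) P y = c V (P' y)\<close> at the vector
    \<open>y = \<rho> a (x + V x)\<close> of \<open>G\<close>.\<close>
  define \<zeta> where "\<zeta> = of_real (1 - p) / c"
  have V_odd: "V (\<rho> a x) = scaleC \<zeta> (\<rho> a (V x))" if a: "a \<in> odd_part A \<sigma>" and x: "x \<in> E" for a x
  proof -
    let ?y = "\<rho> a (x + V x)"
    have y: "?y \<in> G" by (rule odd_G[OF a]) (simp add: V V_simps add.commute)
    have split: "?y = \<rho> a x + \<rho> a (V x)" using linear_simps(1)[OF rho_linear[OF oddD(1)[OF a]]] .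
    have "P ?y = \<rho> a (V x)" "P' ?y = \<rho> a x"
      unfolding split using odd_E[OF a x] odd_E'[OF a VE[OF x]]
      by (simp_all add: linear_simps[OF P_linear] linear_simps[OF P'_linear] P_id P'_id P_zero P'_zero)
    then have "\<rho> a (V x) = p *\<^sub>R \<rho> a (V x) + scaleC c (V (\<rho> a x))" using G_eq[OF y] by simp
    then have "scaleC c (V (\<rho> a x)) = scaleC (of_real (1 - p)) (\<rho> a (V x))"
      by (simp only: scaleC_of_real) (simp add: scaleR_diff_left algebra_simps)
    then have "scaleC (1 / c) (scaleC c (V (\<rho> a x))) = scaleC (1 / c) (scaleC (of_real (1 - p)) (\<rho> a (V x)))"
      by simp
    then show ?thesis using \<open>c \<noteq> 0\<close> by (simp add: scaleC_scaleC \<zeta>_def)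
  qed
  define z where "z = csqrt \<zeta>"
  have z: "z * z = \<zeta>" using power2_csqrt[of \<zeta>] by (simp add: z_def power2_eq_square)
  define F where "F y = P' y - scaleC z (V (P y))" for y
  define L where "L = {y \<in> UNIV. F y = 0}"
  have F: "bounded_linear F" unfolding F_def[abs_def]
    by (intro bounded_linear_sub P'_linear bounded_linear_compose[OF bounded_linear_scaleC]
        bounded_linear_compose[OF V(1) P_linear])
  have LI: "x + scaleC z (V x) \<in> L" if x: "x \<in> E" for x
  proof -
    have "scaleC z (V x) \<in> E'" using closed_csubspaceD(3)[OF closed_E'] VE[OF x] .
    then have "P (x + scaleC z (V x)) = x" "P' (x + scaleC z (V x)) = scaleC z (V x)"
      using x by (simp_all add: linear_simps[OF P_linear] linear_simps[OF P'_linear] P_id P'_id P_zero P'_zero)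
    then show ?thesis by (simp add: L_def F_def)
  qed
  show thesis
  proof (rule that)
    show "closed_csubspace L" unfolding L_def
      by (rule closed_csubspace_kernel[OF _ F])
        (simp_all add: closed_csubspace_def F_def P_scaleC P'_scaleC V scaleC_scaleC scaleC_diff_right mult.commute)
    then have L_add: "x \<in> L \<Longrightarrow> y \<in> L \<Longrightarrow> x + y \<in> L" for x y by (rule closed_csubspaceD)
    have "\<rho> a (x + scaleC z (V x)) \<in> L" if a: "a \<in> carrier A" and x: "x \<in> E" for a x
    proof -
      let ?y = "x + scaleC z (V x)"
      obtain e b where eb: "e \<in> even" "b \<in> odd_part A \<sigma>" "\<rho> a ?y = \<rho> e ?y + \<rho> b ?y"
        using even_odd_split[OF a] by blast
      have "\<rho> e ?y = \<rho> e x + scaleC z (V (\<rho> e x))"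
        using eb(1) by (simp add: linear_simps[OF rho_linear[OF evenD(1)]] rho_scaleC evenD V_even)
      then have 1: "\<rho> e ?y \<in> L" using LI[OF even_E[OF eb(1) x]] by simp
      \<comment> \<open>The component of \<open>\<rho> b ?y\<close> in \<open>E\<close>;
        \<open>z * z = \<zeta>\<close> makes \<open>z V ?x\<close> its component in
        \<open>E'\<close>.\<close>
      let ?x = "scaleC z (\<rho> b (V x))"
      have xE: "?x \<in> E" using closed_csubspaceD(3)[OF closed_E] odd_E'[OF eb(2) VE[OF x]] .
      have "scaleC z (V ?x) = V (scaleC \<zeta> (\<rho> b (V x)))" by (simp add: V scaleC_scaleC z)
      also have "\<dots> = \<rho> b x" using V_odd[OF eb(2) x] V(3) by metis
      finally have "\<rho> b ?y = ?x + scaleC z (V ?x)"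
        using eb(2) by (simp add: linear_simps[OF rho_linear[OF oddD(1)]] rho_scaleC oddD add.commute)
      then have 2: "\<rho> b ?y \<in> L" using LI[OF xE] by simp
      show ?thesis unfolding eb(3) by (rule L_add[OF 1 2])
    qed
    moreover have "y = P y + scaleC z (V (P y))" if "y \<in> L" for y
      using that P_plus_P'[of y] by (simp add: L_def F_def)
    ultimately show "\<rho> a y \<in> L" if "a \<in> carrier A" "y \<in> L" for a y using that P_in by metis
    have "P (v + scaleC z (V v)) = v"
      using v closed_csubspaceD(3)[OF closed_E' VE[OF v(1)]] by (simp add: linear_simps[OF P_linear] P_id P_zero)
    then have "v + scaleC z (V v) \<noteq> 0" using v(2) linear_simps(3)[OF P_linear] by auto
    then show "L \<noteq> {0}" using LI[OF v(1)] by blast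
    have "F (V v) = V v" using VE[OF v(1)] by (simp add: F_def P_zero P'_id V_simps)
    then have "V v \<notin> L" using \<open>V v \<noteq> 0\<close> by (simp add: L_def)
    then show "L \<noteq> UNIV" by blast
  qed
qed

section \<open>Reducibility and equivalence of the diagonal blocks\<close>

text \<open>\<open>V\<close> acts as \<open>U\<close> on \<open>E\<close> and as the inverse of
  \<open>U\<close> on \<open>E'\<close>. Unitarity makes this inverse the adjoint of
  \<open>U\<close>, which gives self-adjointness; exchanging \<open>E\<close> and \<open>E'\<close>
  is anticommutation with \<open>T\<close>.\<close>

lemma unitary_imp_symmetry:
  assumes U: "bij_betw U E E'"
    and U_add: "\<And>x y. x \<in> E \<Longrightarrow> y \<in> E \<Longrightarrow> U (x + y) = U x + U y"
    and U_scaleC: "\<And>c x. x \<in> E \<Longrightarrow> U (scaleC c x) = scaleC c (U x)"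
    and U_inner: "\<And>x y. x \<in> E \<Longrightarrow> y \<in> E \<Longrightarrow> inner (U x) (U y) = inner x y"
    and U_even: "\<And>a x. a \<in> even \<Longrightarrow> x \<in> E \<Longrightarrow> U (\<rho> a x) = \<rho> a (U x)"
  obtains V where "bounded_linear V" "\<And>c x. V (scaleC c x) = scaleC c (V x)" "\<And>x. V (V x) = x"
    "\<And>x y. inner (V x) y = inner x (V y)" "\<And>x. V (T x) = - T (V x)"
    "\<And>a x. a \<in> even \<Longrightarrow> V (\<rho> a x) = \<rho> a (V x)"
proof -
  note E_closed = closed_csubspaceD[OF closed_E] and E'_closed = closed_csubspaceD[OF closed_E']
  note P_simps = linear_simps[OF P_linear] linear_simps[OF P'_linear] P_id P'_id P_zero P'_zero P_in P'_in
  define Ui where "Ui = inv_into E U"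
  have UE: "U x \<in> E'" and UiU: "Ui (U x) = x" if "x \<in> E" for x
    using U that by (auto simp: Ui_def bij_betw_def)
  have UiE: "Ui w \<in> E" and UUi: "U (Ui w) = w" if "w \<in> E'" for w
    using U that inv_into_into[of w U E] f_inv_into_f[of w U E] by (auto simp: Ui_def bij_betw_def)
  have U0: "U 0 = 0" using U_add[OF E_closed(1) E_closed(1)] by simp
  have Ui0: "Ui 0 = 0" using UiU[OF E_closed(1)] by (simp add: U0)
  have Ui_add: "Ui (w + w') = Ui w + Ui w'" if "w \<in> E'" "w' \<in> E'" for w w'
    using UiU[of "Ui w + Ui w'"] that by (simp add: E_closed UiE U_add UUi)
  have Ui_scaleC: "Ui (scaleC c w) = scaleC c (Ui w)" if "w \<in> E'" for c w
    using UiU[of "scaleC c (Ui w)"] that by (simp add: E_closed UiE U_scaleC UUi)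
  have Ui_even: "Ui (\<rho> a w) = \<rho> a (Ui w)" if "a \<in> even" "w \<in> E'" for a w
    using UiU[of "\<rho> a (Ui w)"] that by (simp add: even_E UiE U_even UUi)
  have U_adj: "inner (U x) w = inner x (Ui w)" if "x \<in> E" "w \<in> E'" for x w
    using U_inner[OF that(1) UiE[OF that(2)]] by (simp add: UUi that)
  define V where "V x = U (P x) + Ui (P' x)" for x
  have VE: "V x = U x" if "x \<in> E" for x using that by (simp add: V_def P_simps Ui0)
  have VE': "V x = Ui x" if "x \<in> E'" for x using that by (simp add: V_def P_simps U0)
  have V_add: "V (x + y) = V x + V y" for x y
    by (simp add: V_def P_simps U_add Ui_add)
  have VC: "V (scaleC c x) = scaleC c (V x)" for c x
    by (simp add: V_def P_scaleC P'_scaleC U_scaleC Ui_scaleC P_simps scaleC_add_right)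
  have PV: "P (V x) = Ui (P' x)" and P'V: "P' (V x) = U (P x)" for x
    using UE[OF P_in[of x]] UiE[OF P'_in[of x]] by (simp_all add: V_def P_simps)
  have VV: "V (V x) = x" for x
    using P_plus_P'[of x] by (simp add: V_def[of "V x"] PV P'V UiU UUi P_in P'_in add.commute)
  have V_sa: "inner (V x) y = inner x (V y)" for x y
  proof -
    have "inner (V x) y = inner (U (P x) + Ui (P' x)) (P y + P' y)" by (simp add: V_def P_plus_P')
    also have "\<dots> = inner (U (P x)) (P' y) + inner (Ui (P' x)) (P y)"
      using E_E'_orthogonal[OF P_in UE[OF P_in], of y x] E_E'_orthogonal[OF UiE[OF P'_in] P'_in, of x y]
      by (simp add: inner_add_left inner_add_right inner_commute)
    also have "\<dots> = inner (P x) (Ui (P' y)) + inner (P' x) (U (P y))"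
      using U_adj[OF P_in P'_in] U_adj[OF P_in P'_in, of y x] by (simp add: inner_commute)
    also have "\<dots> = inner (P x + P' x) (U (P y) + Ui (P' y))"
      using E_E'_orthogonal[OF P_in UE[OF P_in], of x y] E_E'_orthogonal[OF UiE[OF P'_in] P'_in, of y x]
      by (simp add: inner_add_left inner_add_right inner_commute)
    finally show ?thesis by (simp add: V_def P_plus_P')
  qed
  have "norm (V x) = norm x" for x
    using V_sa[of x "V x"] by (simp add: VV norm_eq_sqrt_inner)
  then have V: "bounded_linear V"
    using VC[of "of_real r" for r] V_add by (intro bounded_linear_intro[of _ 1]) (auto simp: scaleC_of_real)
  have TP: "T x = P x - P' x" for x by (simp add: P_def P'_def flip: scaleR_diff_right scaleR_2)
  show thesis
  proof (rule that[OF V VC VV V_sa])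
    show "V (T x) = - T (V x)" for x
      unfolding TP[of x] TP[of "V x"] PV P'V linear_simps(2)[OF V] by (simp add: VE VE' P_in P'_in)
    show "V (\<rho> a x) = \<rho> a (V x)" if a: "a \<in> even" for a x
    proof -
      have "\<rho> a x = \<rho> a (P x) + \<rho> a (P' x)"
        using P_plus_P'[of x] linear_simps(1)[OF rho_linear[OF evenD(1)[OF a]]] by metis
      then show ?thesis
        using a even_E[OF a P_in] even_E'[OF a P'_in] linear_simps(1)[OF rho_linear[OF evenD(1)[OF a]]]
        by (simp add: V_add VE VE' U_even Ui_even P_in P'_in) (simp add: V_def)
    qed
  qed
qed

lemma block_E': "block E' E' (\<rho> a) = (\<lambda>x. if x \<in> E' then P' (\<rho> a x) else 0)"
  by (simp add: block_def orth_proj_E' fun_eq_iff)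

lemma block_even':
  assumes "a \<in> even" "x \<in> E'"
  shows "block E' E' (\<rho> a) x = \<rho> a x"
  using assms by (simp add: block_E' P'_id even_E')

lemma carrier_fixed_algebra: "carrier (fixed_algebra A \<sigma>) = even"
  by (simp add: fixed_algebra_def even_def)

lemma irreducible_iff_not_equivalent:
  assumes "E \<noteq> {0}" "E' \<noteq> {0}"
  shows "irreducible_representation A UNIV \<rho> \<longleftrightarrow>
    \<not> unitarily_equivalent (fixed_algebra A \<sigma>) E (\<lambda>a. block E E (\<rho> a)) E' (\<lambda>a. block E' E' (\<rho> a))"
proof
  assume irred: "irreducible_representation A UNIV \<rho>"
  show "\<not> unitarily_equivalent (fixed_algebra A \<sigma>) E (\<lambda>a. block E E (\<rho> a)) E' (\<lambda>a. block E' E' (\<rho> a))"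
  proof
    assume "unitarily_equivalent (fixed_algebra A \<sigma>) E (\<lambda>a. block E E (\<rho> a)) E' (\<lambda>a. block E' E' (\<rho> a))"
    then obtain U where U: "bij_betw U E E'" "\<forall>x\<in>E. \<forall>y\<in>E. U (x + y) = U x + U y"
      "\<forall>c. \<forall>x\<in>E. U (scaleC c x) = scaleC c (U x)"
      "\<forall>x\<in>E. \<forall>y\<in>E. cinner (U x) (U y) = cinner x y"
      "\<forall>a\<in>even. \<forall>x\<in>E. U (block E E (\<rho> a) x) = block E' E' (\<rho> a) (U x)"
      unfolding unitarily_equivalent_def carrier_fixed_algebra by blast
    have UE: "U x \<in> E'" if "x \<in> E" for x using U(1) that by (auto simp: bij_betw_def)
    obtain V where V: "bounded_linear V" "\<And>c x. V (scaleC c x) = scaleC c (V x)" "\<And>x. V (V x) = x"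
      "\<And>x y. inner (V x) y = inner x (V y)" "\<And>x. V (T x) = - T (V x)"
      "\<And>a x. a \<in> even \<Longrightarrow> V (\<rho> a x) = \<rho> a (V x)"
    proof (rule unitary_imp_symmetry[OF U(1)])
      show "U (\<rho> a x) = \<rho> a (U x)" if "a \<in> even" "x \<in> E" for a x
        using U(5) that by (simp add: block_even block_even' UE)
    qed (use U in \<open>auto simp: inner_eq_Re_cinner\<close>)
    obtain L where "closed_csubspace L" "\<And>a x. a \<in> carrier A \<Longrightarrow> x \<in> L \<Longrightarrow> \<rho> a x \<in> L"
      "L \<noteq> {0}" "L \<noteq> UNIV"
      by (rule symmetry_imp_reducible[OF V assms(1)]) (assumption, rule that)
    then show False using irred by (auto simp: irreducible_representation_def)
  qed
next
  assume neq: "\<not> unitarily_equivalent (fixed_algebra A \<sigma>) E (\<lambda>a. block E E (\<rho> a)) E' (\<lambda>a. block E' E' (\<rho> a))"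
  have "L = {0} \<or> L = UNIV" if L: "closed_csubspace L" "\<And>a x. a \<in> carrier A \<Longrightarrow> x \<in> L \<Longrightarrow> \<rho> a x \<in> L" for L
  proof (rule ccontr)
    assume "\<not> (L = {0} \<or> L = UNIV)"
    then have L': "L \<noteq> {0}" "L \<noteq> UNIV" by auto
    obtain V where V: "bounded_linear V" "\<And>c x. V (scaleC c x) = scaleC c (V x)" "\<And>x. V (V x) = x"
      "\<And>x y. inner (V x) y = inner x (V y)" "\<And>x. V (T x) = - T (V x)"
      "\<And>a x. a \<in> carrier A \<Longrightarrow> V (\<rho> a x) = \<rho> a (V x)"
      by (rule reducible_imp_symmetry[OF L L']) (assumption+, rule that)
    have VE: "V x \<in> E'" if "x \<in> E" for x using that V(5)[of x] by (auto simp: E_def E'_def equation_minus_iff)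
    have VE': "V x \<in> E" if "x \<in> E'" for x
      using that V(5)[of x] by (simp add: E_def E'_def linear_simps[OF V(1)])
    \<comment> \<open>An involution that anticommutes with \<open>T\<close> exchanges the
      eigenspaces; its restriction to \<open>E\<close> is the equivalence.\<close>
    have "bij_betw V E E'" by (rule bij_betwI[where g = V]) (auto simp: VE VE' V(3))
    moreover have "inner (V x) (V y) = inner x y" for x y by (simp add: V(3,4))
    then have "cinner (V x) (V y) = cinner x y" for x y
      by (simp add: cinner_eq_Complex_inner flip: V(2))
    ultimately have "unitarily_equivalent (fixed_algebra A \<sigma>) E (\<lambda>a. block E E (\<rho> a)) E' (\<lambda>a. block E' E' (\<rho> a))"
      unfolding unitarily_equivalent_def carrier_fixed_algebra
      by (intro exI[of _ V]) (simp add: linear_simps[OF V(1)] V(2,6) block_even block_even' VE evenD)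
    then show False using neq by blast
  qed
  then show "irreducible_representation A UNIV \<rho>"
    by (simp add: irreducible_representation_def rep)
qed

section \<open>The spectrum of the symmetry and the scalar case\<close>

lemma spectrum_T:
  assumes "E \<noteq> {0}" "E' \<noteq> {0}"
  shows "operator_spectrum T = {-1, 1}"
proof (rule Set.set_eqI)
  fix z
  have S0: "S 0 = 0" if "bounded_operator_on UNIV S" for S :: "'h \<Rightarrow> 'h"
    using linear_simps(3)[OF bounded_operator_imp_bounded_linear[OF that]] .
  obtain x y where x: "T x = x" "x \<noteq> 0" and y: "T y = - y" "y \<noteq> 0"
    using assms closed_csubspaceD(1)[OF closed_E] closed_csubspaceD(1)[OF closed_E']
    unfolding E_def E'_def by blast
  have "z \<in> operator_spectrum T" if "z = 1 \<or> z = -1"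
  proof -
    have "T x - scaleC 1 x = 0" "T y - scaleC (-1) y = 0" using x y by simp_all
    then show ?thesis using that x(2) y(2) S0 unfolding operator_spectrum_def mem_Collect_eq by metis
  qed
  moreover have "z \<notin> operator_spectrum T" if "z \<noteq> 1" "z \<noteq> -1"
  proof -
    have nz: "1 - z * z \<noteq> 0" using that by (metis eq_iff_diff_eq_0 square_eq_1_iff)
    \<comment> \<open>The resolvent, from \<open>(T - z) (T + z) = 1 - z^2\<close>.\<close>
    define S where "S u = scaleC (1 / (1 - z * z)) (T u + scaleC z u)" for u
    have *: "scaleC (1 / (1 - z * z)) (u - scaleC (z * z) u) = u" for u :: 'h
    proof -
      have "u - scaleC (z * z) u = scaleC (1 - z * z) u"
        using scaleC_add_left[of "1 - z * z" "z * z" u] by (simp add: diff_eq_eq)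
      then show ?thesis using nz by (simp add: scaleC_scaleC)
    qed
    have "bounded_operator_on UNIV S"
      unfolding bounded_operator_on_UNIV S_def[abs_def]
      by (auto intro!: bounded_linear_compose[OF bounded_linear_scaleC] bounded_linear_add T_linear
          bounded_linear_scaleC simp: T_scaleC scaleC_scaleC scaleC_add_right mult.commute)
    moreover have "S (T u - scaleC z u) = u" "T (S u) - scaleC z (S u) = u" for u
      using *[of u] by (simp_all add: S_def linear_simps[OF T_linear] T_T T_scaleC scaleC_add_right
          scaleC_diff_right scaleC_scaleC mult.commute)
    ultimately show ?thesis unfolding operator_spectrum_def by blast
  qed
  ultimately show "z \<in> operator_spectrum T \<longleftrightarrow> z \<in> {-1, 1}" by blast
qed

text \<open>Makes the two alternatives exclusive: \<open>T + 1\<close> or \<open>T - 1\<close> is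
  then 2 or -2 times the identity, with an explicit inverse.\<close>

lemma spectrum_T_trivial:
  assumes "T = (\<lambda>x. x) \<or> T = (\<lambda>x. - x)"
  shows "operator_spectrum T \<noteq> {-1, 1}"
proof -
  define S where "S r x = r *\<^sub>R x" for r and x :: 'h
  have S: "bounded_operator_on UNIV (S r)" for r
    by (simp add: bounded_operator_on_UNIV S_def[abs_def] bounded_linear_scaleR_right scaleC_scaleR)
  have half: "(1/2) *\<^sub>R x + (1/2) *\<^sub>R x = x" for x :: 'h by (simp flip: scaleR_add_left)
  have "-1 \<notin> operator_spectrum T" if "T = (\<lambda>x. x)"
  proof -
    have "S (1/2) (T x - scaleC (-1) x) = x" "T (S (1/2) x) - scaleC (-1) (S (1/2) x) = x" for x
      by (simp_all add: S_def that half scaleR_half_double)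
    then show ?thesis using S unfolding operator_spectrum_def by blast
  qed
  moreover have "1 \<notin> operator_spectrum T" if "T = (\<lambda>x. - x)"
  proof -
    have "S (-1/2) (T x - scaleC 1 x) = x" "T (S (-1/2) x) - scaleC 1 (S (-1/2) x) = x" for x
      by (simp_all add: S_def that half scaleR_diff_right)
    then show ?thesis using S unfolding operator_spectrum_def by blast
  qed
  ultimately show ?thesis using assms by blast
qed

lemma T_trivial_odd:
  assumes "T = (\<lambda>x. x) \<or> T = (\<lambda>x. - x)" "b \<in> odd_part A \<sigma>"
  shows "\<rho> b x = 0"
proof -
  have "\<rho> b x = - \<rho> b x"
    using assms(1) T_odd[OF assms(2), of x] linear_simps(4)[OF rho_linear[OF oddD(1)[OF assms(2)]]]
    by auto
  then have "2 *\<^sub>R \<rho> b x = 0" by (simp add: scaleR_2 eq_neg_iff_add_eq_0)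
  then show ?thesis by simp
qed

lemma T_trivial_image:
  assumes "T = (\<lambda>x. x) \<or> T = (\<lambda>x. - x)"
  shows "\<rho> ` carrier A = \<rho> ` even"
proof -
  have "\<rho> a \<in> \<rho> ` even" if a: "a \<in> carrier A" for a
  proof -
    obtain e b where eb: "e \<in> even" "b \<in> odd_part A \<sigma>" "\<And>x. \<rho> a x = \<rho> e x + \<rho> b x"
      using even_odd_split[OF a] by blast
    then have "\<rho> a = \<rho> e" using T_trivial_odd[OF assms eb(2)] by auto
    then show ?thesis using eb(1) by blast
  qed
  then show ?thesis using evenD by blast
qed

lemma T_trivial_iff: "T = (\<lambda>x. x) \<or> T = (\<lambda>x. - x) \<longleftrightarrow> E = {0} \<or> E' = {0}"
proof -
  have "T = (\<lambda>x. x) \<longleftrightarrow> E' = {0}"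
  proof
    assume "E' = {0}"
    then have "x = P x" for x using P'_in[of x] P_plus_P'[of x] by simp
    then have "T x = x" for x using P_in[of x] by (simp add: E_def)
    then show "T = (\<lambda>x. x)" by auto
  next
    assume T: "T = (\<lambda>x. x)"
    have "T x = x" for x by (simp add: T)
    then have "x \<in> E" for x by (simp add: E_def)
    then show "E' = {0}" using E_Int_E' closed_csubspaceD(1)[OF closed_E'] by blast
  qed
  moreover have "T = (\<lambda>x. - x) \<longleftrightarrow> E = {0}"
  proof
    assume "E = {0}"
    then have "x = P' x" for x using P_in[of x] P_plus_P'[of x] by simp
    then have "T x = - x" for x using P'_in[of x] by (simp add: E'_def)
    then show "T = (\<lambda>x. - x)" by auto
  next
    assume T: "T = (\<lambda>x. - x)"
    have "T x = - x" for x by (simp add: T)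
    then have "x \<in> E'" for x by (simp add: E'_def)
    then show "E = {0}" using E_Int_E' closed_csubspaceD(1)[OF closed_E] by blast
  qed
  ultimately show ?thesis by blast
qed

lemma hilbert_direct_sum_E: "hilbert_direct_sum E E'"
  unfolding hilbert_direct_sum_def
proof (intro conjI ballI allI closed_E closed_E')
  show "cinner x y = 0" if "x \<in> E" "y \<in> E'" for x y
    using that closed_csubspaceD(3)[OF closed_E]
    by (simp add: cinner_eq_Complex_inner E_E'_orthogonal complex_eq_iff)
  show "\<exists>y\<in>E. \<exists>z\<in>E'. x = y + z" for x using P_plus_P' P_in P'_in by metis
qed

lemma eigenspaces_T: "eigenspace T 1 = E" "eigenspace T (-1) = E'"
  by (simp_all add: eigenspace_def E_def E'_def)

lemma T_E: "x \<in> E \<Longrightarrow> T x = x" and T_E': "x \<in> E' \<Longrightarrow> T x = - x"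
  by (simp_all add: E_def E'_def)

text \<open>Needed for the image of the odd part under a block to be the singleton of the zero map
  rather than empty.\<close>

lemma zero_in_odd_part: "\<zero> \<in> odd_part A \<sigma>"
  using sigma_scale[of \<zero> 0] by (simp add: odd_part_def scale_zero_left sigma_closed)

end

section \<open>Transfer to the crossed product\<close>

text \<open>Every element of \<open>B\<close> is exactly of the form \<open>a + b W\<close>, so a
  subspace invariant under \<open>\<iota> A\<close> and \<open>W\<close> is invariant under
  \<open>B\<close>; irreducibility of \<open>\<pi>\<close> thus becomes the locale assumption
  \<open>irr\<close>.\<close>

lemma crossed_product_covariant_irrep:
  assumes A: "cstar_algebra A" and sigma: "order_two_automorphism A \<sigma>"
    and B: "crossed_product_Z2 A \<sigma> B \<iota> W"
    and irrep: "irreducible_representation B UNIV \<pi>"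
  shows "covariant_irrep A \<sigma> (\<lambda>a. \<pi> (\<iota> a)) (\<pi> W)"
proof -
  interpret A: cstar_algebra A by fact
  interpret B: cstar_algebra B using B by (simp add: crossed_product_Z2_def)
  have \<iota>: "star_morphism A B \<iota>" and cov: "covariant_unitary A \<sigma> B \<iota> W"
    using B by (auto simp: crossed_product_Z2_def)
  have \<iota>c: "a \<in> carrier A \<Longrightarrow> \<iota> a \<in> carrier B" for a using \<iota> by (simp add: star_morphism_def)
  have W: "W \<in> carrier B" "W \<otimes>\<^bsub>B\<^esub> W = \<one>\<^bsub>B\<^esub>" using cov by (simp_all add: covariant_unitary_def)
  have rep: "representation B UNIV \<pi>" using irrep by (simp add: irreducible_representation_def)
  have \<pi>m: "\<pi> (x \<otimes>\<^bsub>B\<^esub> y) u = \<pi> x (\<pi> y u)" and \<pi>a: "\<pi> (x \<oplus>\<^bsub>B\<^esub> y) u = \<pi> x u + \<pi> y u"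
    if "x \<in> carrier B" "y \<in> carrier B" for x y u
    using rep that by (simp_all add: representation_def)
  show ?thesis
  proof (intro covariant_irrep.intro covariant_irrep_axioms.intro A sigma)
    show "representation A UNIV (\<lambda>a. \<pi> (\<iota> a))"
      using rep \<iota> by (simp add: representation_def star_morphism_def)
    show "bounded_operator_on UNIV (\<pi> W)" using rep W by (simp add: representation_def)
    show "\<pi> W (\<pi> W x) = x" for x
      using \<pi>m[OF W(1) W(1), of x] rep by (simp add: W(2) representation_def)
    have "cinner (\<pi> (star B W) x) y = cinner x (\<pi> W y)" for x y
      using rep W by (simp add: representation_def)
    then show "inner (\<pi> W x) y = inner x (\<pi> W y)" for x y
      by (simp add: inner_eq_Re_cinner covariant_unitary_star[OF B.cstar_algebra_axioms cov])
    show "\<pi> W (\<pi> (\<iota> a) x) = \<pi> (\<iota> (\<sigma> a)) (\<pi> W x)" if a: "a \<in> carrier A" for a x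
    proof -
      have "\<sigma> a \<in> carrier A"
        using sigma a by (simp add: order_two_automorphism_def star_morphism_def)
      then show ?thesis
        using covariant_unitary_mult[OF B.cstar_algebra_axioms cov a \<iota>c[OF a]] W a \<iota>c
        by (simp flip: \<pi>m)
    qed
    fix L assume L: "closed_csubspace L" "\<And>a x. a \<in> carrier A \<Longrightarrow> x \<in> L \<Longrightarrow> \<pi> (\<iota> a) x \<in> L"
      "\<And>x. x \<in> L \<Longrightarrow> \<pi> W x \<in> L" "L \<noteq> {0}"
    have "\<pi> b x \<in> L" if b: "b \<in> carrier B" and x: "x \<in> L" for b x
    proof -
      obtain a c where "a \<in> carrier A" "c \<in> carrier A" "b = \<iota> a \<oplus>\<^bsub>B\<^esub> \<iota> c \<otimes>\<^bsub>B\<^esub> W"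
        using crossed_product_Z2_decomposition[OF A sigma B b] by blast
      then show ?thesis
        using L(2,3) x W closed_csubspaceD(2)[OF L(1)] by (simp add: \<pi>a \<pi>m \<iota>c)
    qed
    then show "L = UNIV"
      using irrep L(1,4) by (auto simp: irreducible_representation_def)
  qed
qed

theorem theorem2p6:
  fixes A :: "'a star_algebra" and \<sigma> :: "'a \<Rightarrow> 'a"
    and B :: "'b star_algebra" and \<iota> :: "'a \<Rightarrow> 'b" and W :: 'b
    and \<pi> :: "'b \<Rightarrow> 'h::complex_hilbert \<Rightarrow> 'h"
  defines A1_def: "A1 \<equiv> fixed_algebra A \<sigma>"
    and pi'_def: "\<pi>' \<equiv> \<lambda>a. \<pi> (\<iota> a)"
    and H1_def: "H1 \<equiv> eigenspace (\<pi> W) 1"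
    and Hm_def: "Hm \<equiv> eigenspace (\<pi> W) (-1)"
  defines alpha_def: "\<alpha> \<equiv> \<lambda>a. block H1 H1 (\<pi>' a)"
    and beta_def: "\<beta> \<equiv> \<lambda>a. block H1 Hm (\<pi>' a)"
    and gamma_def: "\<gamma> \<equiv> \<lambda>a. block Hm H1 (\<pi>' a)"
    and delta_def: "\<delta> \<equiv> \<lambda>a. block Hm Hm (\<pi>' a)"
  defines case1_def: "case1 \<equiv> \<pi> W = (\<lambda>x. x) \<or> \<pi> W = (\<lambda>x. - x)"
    and case2_def: "case2 \<equiv> operator_spectrum (\<pi> W) = {-1, 1}"
  assumes A: "cstar_algebra A"
    and sigma: "order_two_automorphism A \<sigma>"
    and B: "crossed_product_Z2 A \<sigma> B \<iota> W"
    and irr: "irreducible_representation B UNIV \<pi>"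
  shows "((case1 \<and> \<not> case2) \<or> (case2 \<and> \<not> case1)) \<and>
         (case1 \<longrightarrow>
            \<pi> ` carrier B = \<pi>' ` carrier A \<and> \<pi>' ` carrier A = \<pi>' ` carrier A1) \<and>
         (case2 \<longrightarrow>
            hilbert_direct_sum H1 Hm \<and>
            (\<forall>x\<in>H1. block H1 H1 (\<pi> W) x = x) \<and> (\<forall>x\<in>Hm. block H1 Hm (\<pi> W) x = 0) \<and>
            (\<forall>x\<in>H1. block Hm H1 (\<pi> W) x = 0) \<and> (\<forall>x\<in>Hm. block Hm Hm (\<pi> W) x = - x) \<and>
            (\<forall>a\<in>carrier A. \<forall>x\<in>H1. \<forall>y\<in>Hm.
               \<pi>' a (x + y) = (\<alpha> a x + \<beta> a y) + (\<gamma> a x + \<delta> a y)) \<and>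
            irreducible_representation A1 H1 \<alpha> \<and> irreducible_representation A1 Hm \<delta> \<and>
            \<alpha> ` odd_part A \<sigma> = {\<lambda>_. 0} \<and> \<delta> ` odd_part A \<sigma> = {\<lambda>_. 0} \<and>
            \<beta> ` carrier A1 = {\<lambda>_. 0} \<and> \<gamma> ` carrier A1 = {\<lambda>_. 0} \<and>
            (irreducible_representation A UNIV \<pi>' \<longleftrightarrow>
               \<not> unitarily_equivalent A1 H1 \<alpha> Hm \<delta>))"
proof -
  have rep_B: "representation B UNIV \<pi>" using irr by (simp add: irreducible_representation_def)
  interpret covariant_irrep A \<sigma> \<pi>' "\<pi> W"
    unfolding pi'_def by (rule crossed_product_covariant_irrep[OF A sigma B irr])
  have spaces: "H1 = E" "Hm = E'" by (simp_all add: H1_def Hm_def eigenspaces_T)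
  have A1: "carrier A1 = even" by (simp add: A1_def carrier_fixed_algebra)
  have case1: "case1 \<longleftrightarrow> E = {0} \<or> E' = {0}" unfolding case1_def by (rule T_trivial_iff)
  have excl: "(case1 \<and> \<not> case2) \<or> (case2 \<and> \<not> case1)"
    using spectrum_T spectrum_T_trivial T_trivial_iff unfolding case1_def case2_def by blast
  have first: "\<pi> ` carrier B = \<pi>' ` carrier A \<and> \<pi>' ` carrier A = \<pi>' ` carrier A1" if case1
  proof
    have W: "W \<in> carrier B" and \<iota>c: "a \<in> carrier A \<Longrightarrow> \<iota> a \<in> carrier B" for a
      using B by (auto simp: crossed_product_Z2_def covariant_unitary_def star_morphism_def)
    interpret B: cstar_algebra B using B by (simp add: crossed_product_Z2_def)
    have "\<pi> b \<in> \<pi>' ` carrier A" if b: "b \<in> carrier B" for b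
    proof -
      obtain a c where ac: "a \<in> carrier A" "c \<in> carrier A" "b = \<iota> a \<oplus>\<^bsub>B\<^esub> \<iota> c \<otimes>\<^bsub>B\<^esub> W"
        using crossed_product_Z2_decomposition[OF A sigma B b] by blast
      have "\<pi> b x = \<pi>' a x + \<pi>' c (\<pi> W x)" for x
        using rep_B ac W by (simp add: representation_def \<iota>c pi'_def)
      \<comment> \<open>\<open>W\<close> acts as 1 or -1, so the second coefficient is absorbed with
        that sign.\<close>
      then have "\<pi> b = \<pi>' (a \<oplus>\<^bsub>A\<^esub> c) \<or> \<pi> b = \<pi>' (a \<oplus>\<^bsub>A\<^esub> \<ominus>\<^bsub>A\<^esub> c)"
        using \<open>case1\<close> ac(1,2) unfolding case1_def fun_eq_iff
        by (auto simp: rho_plus rho_uminus linear_simps(4)[OF rho_linear])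
      then show ?thesis using ac(1,2) by auto
    qed
    then show "\<pi> ` carrier B = \<pi>' ` carrier A" by (auto simp: pi'_def \<iota>c)
    show "\<pi>' ` carrier A = \<pi>' ` carrier A1"
      unfolding A1 using \<open>case1\<close> by (intro T_trivial_image) (simp add: case1_def)
  qed
  have images: "\<alpha> ` odd_part A \<sigma> = {\<lambda>_. 0}" "\<delta> ` odd_part A \<sigma> = {\<lambda>_. 0}"
    "\<beta> ` carrier A1 = {\<lambda>_. 0}" "\<gamma> ` carrier A1 = {\<lambda>_. 0}"
  proof -
    have "\<alpha> b = (\<lambda>_. 0)" "\<delta> b = (\<lambda>_. 0)" if "b \<in> odd_part A \<sigma>" for b
      using that by (auto simp: alpha_def delta_def spaces block_E block_E' P_zero P'_zero odd_E odd_E')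
    moreover have "\<beta> a = (\<lambda>_. 0)" "\<gamma> a = (\<lambda>_. 0)" if "a \<in> even" for a
      using that by (auto simp: beta_def gamma_def spaces block_def orth_proj_E orth_proj_E'
          P_zero P'_zero even_E even_E')
    ultimately show "\<alpha> ` odd_part A \<sigma> = {\<lambda>_. 0}" "\<delta> ` odd_part A \<sigma> = {\<lambda>_. 0}"
      "\<beta> ` carrier A1 = {\<lambda>_. 0}" "\<gamma> ` carrier A1 = {\<lambda>_. 0}"
      unfolding A1 using zero_in_odd_part even_one by (force simp: image_iff)+
  qed
  have decomp: "\<pi>' a (x + y) = (\<alpha> a x + \<beta> a y) + (\<gamma> a x + \<delta> a y)"
    if "a \<in> carrier A" "x \<in> H1" "y \<in> Hm" for a x y
  proof -
    have "(\<alpha> a x + \<beta> a y) + (\<gamma> a x + \<delta> a y)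
        = (P (\<pi>' a x) + P' (\<pi>' a x)) + (P (\<pi>' a y) + P' (\<pi>' a y))"
      using that by (simp add: alpha_def beta_def gamma_def delta_def spaces block_def orth_proj_E orth_proj_E')
    then show ?thesis using that(1) by (simp add: P_plus_P' linear_simps(1)[OF rho_linear])
  qed
  have W_blocks: "\<forall>x\<in>H1. block H1 H1 (\<pi> W) x = x" "\<forall>x\<in>Hm. block H1 Hm (\<pi> W) x = 0"
    "\<forall>x\<in>H1. block Hm H1 (\<pi> W) x = 0" "\<forall>x\<in>Hm. block Hm Hm (\<pi> W) x = - x"
    by (simp_all add: spaces block_def orth_proj_E orth_proj_E' T_E T_E' P_id P_zero P'_id P'_zero
        linear_simps(4)[OF P_linear] linear_simps(4)[OF P'_linear])
  show ?thesis
  proof (intro conjI impI excl)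
    assume case2
    then have ne: "E \<noteq> {0}" "E' \<noteq> {0}" using excl case1 by auto
    show "irreducible_representation A1 H1 \<alpha>" "irreducible_representation A1 Hm \<delta>"
      using irreducible_representation_block[OF ne(1)] irreducible_representation_block'[OF ne(2)]
      by (simp_all add: A1_def alpha_def delta_def spaces)
    show "irreducible_representation A UNIV \<pi>' \<longleftrightarrow> \<not> unitarily_equivalent A1 H1 \<alpha> Hm \<delta>"
      using irreducible_iff_not_equivalent[OF ne] by (simp add: A1_def alpha_def delta_def spaces)
    show "hilbert_direct_sum H1 Hm" by (simp add: spaces hilbert_direct_sum_E)
  qed (use first images decomp W_blocks in auto)
qed

end
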